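(* Let $\mathcal{S}$ denote the support of the law of the $C([0,1])$-valued random variable $$\mathrm{K}(t)=t\,\mathrm{ST}_0+\sum_{h\neq 0}\frac{e(ht)-1}{2\pi i h}\mathrm{ST}_h,\qquad 0\le t\le 1.$$ Then $\mathcal{S}$ is exactly the set of all $f\in C([0,1])$ such that $f(0)=0$, $f(1)\in[-2,2]$, and such that the function $g(t)=f(t)-tf(1)$ satisfies, for every non-zero integer $h$, $$\widehat{g}(h)\in i\mathbf{R}\quad\text{and}\quad |\widehat{g}(h)|\le \frac{1}{\pi|h|},$$ where $\widehat{g}(h)=\int_0^1 g(t)e(-ht)\,dt$.
   Context: $e(z)=e^{2i\pi z}$. $C([0,1])$ is the Banach space of continuous complex-valued functions on $[0,1]$ with the sup norm. $(\mathrm{ST}_h)_{h\in\mathbf{Z}}$ is a family of independent real random variables, each with the Sato–Tate law $\frac{1}{\pi}\sqrt{1-\frac{x^2}{4}}\,dx$ on $[-2,2]$; the series defining $\mathrm{K}$ converges almost surely uniformly on $[0,1]$ in the sense of symmetric partial sums (over $|h|\le N$, $N\to\infty$), so $\mathrm{K}$ is a $C([0,1])$-valued random variable. The support of its law is the set of $f\in C([0,1])$ such that every open neighbourhood of $f$ has positive probability. *)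

theory Defs
  imports "HOL-Probability.Probability"
begin

definition ecirc :: "real \<Rightarrow> complex" where
  "ecirc x = exp (2 * of_real pi * \<i> * of_real x)"

definition sato_tate_density :: "real \<Rightarrow> ennreal" where
  "sato_tate_density x = (if x \<in> {-2..2} then ennreal (sqrt (1 - x^2 / 4) / pi) else 0)"

definition K_partial :: "(int \<Rightarrow> 'a \<Rightarrow> real) \<Rightarrow> nat \<Rightarrow> 'a \<Rightarrow> real \<Rightarrow> complex" where
  "K_partial ST N \<omega> t =
     of_real t * of_real (ST 0 \<omega>) +
     (\<Sum>h\<in>{-int N..int N} - {0}.
        (ecirc (of_int h * t) - 1) / (2 * of_real pi * \<i> * of_int h) * of_real (ST h \<omega>))"

text \<open>The random function K: the uniform limit on [0,1] of the symmetric partial sums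
  where it exists (almost surely), and 0 on the remaining null set.\<close>
definition K_fun :: "(int \<Rightarrow> 'a \<Rightarrow> real) \<Rightarrow> 'a \<Rightarrow> real \<Rightarrow> complex" where
  "K_fun ST \<omega> t =
     (if \<exists>g. uniform_limit {0..1} (\<lambda>N. K_partial ST N \<omega>) g sequentially
      then lim (\<lambda>N. K_partial ST N \<omega> t) else 0)"

definition K_support :: "'a measure \<Rightarrow> (int \<Rightarrow> 'a \<Rightarrow> real) \<Rightarrow> (real \<Rightarrow> complex) set" where
  "K_support M ST = {f. continuous_on {0..1} f \<and>
     (\<forall>\<epsilon>>0. measure M {\<omega> \<in> space M. (SUP t\<in>{0..1}. cmod (K_fun ST \<omega> t - f t)) < \<epsilon>} > 0)}"

definition fourier_coeff :: "(real \<Rightarrow> complex) \<Rightarrow> int \<Rightarrow> complex" where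
  "fourier_coeff g h = integral {0..1} (\<lambda>t. g t * ecirc (- (of_int h * t)))"

end

theory Submission
  imports Defs "HOL-Real_Asymp.Real_Asymp"
begin

text \<open>
  Both sides are identified with the uniform closure of the polynomials
  \<open>t y\<^sub>0 + (\<Sum>0<\<bar>h\<bar>\<le>N. y\<^sub>h (e(ht) - 1) / (2\<pi>ih))\<close> with all \<open>y\<^sub>h\<close> in [-2,2].

  The conditions on the Fourier coefficients are closed and hold for these polynomials. Conversely,
  the Cesaro means of \<open>g\<close> converge to \<open>g\<close> uniformly by Fejer's theorem, and passing to them only
  multiplies the coefficients by weights in [0,1], which keeps them admissible.

  A function in the support is approximated by values of K, hence by such polynomials. Conversely, K is
  close to a given polynomial as soon as finitely many \<open>ST\<^sub>h\<close> are close to its coefficients and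
  the tail of the series is small. These two events are independent. The first has positive
  probability because the Sato-Tate density is positive on (-2,2). For the second, Hoeffding's
  inequality on a grid bounds \<open>\<Sum>M<\<bar>h\<bar>\<le>n. sgn(h) (e(ht) - 1) ST\<^sub>h\<close> by a multiple of \<open>n\<^sup>3\<^sup>/\<^sup>4\<close> for all
  \<open>n > M\<close> at once with positive probability, and Abel summation turns this into uniform
  convergence with a tail of size at most a multiple of \<open>\<Sum>n\<ge>M. n\<^sup>-\<^sup>5\<^sup>/\<^sup>4\<close>.
\<close>

section \<open>Fejer approximation on the circle\<close>

lemma ecirc_eq_cis: "ecirc x = cis (2 * pi * x)"
  by (simp add: ecirc_def cis_conv_exp mult_ac)

lemma ecirc_0 [simp]: "ecirc 0 = 1"
  by (simp add: ecirc_eq_cis)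

lemma ecirc_of_int [simp]: "ecirc (of_int n) = 1"
  by (simp add: ecirc_eq_cis)

lemma ecirc_add: "ecirc (x + y) = ecirc x * ecirc y"
  by (simp add: ecirc_eq_cis cis_mult ring_distribs)

lemma norm_ecirc [simp]: "cmod (ecirc x) = 1"
  by (simp add: ecirc_eq_cis)

lemma cnj_ecirc: "cnj (ecirc x) = ecirc (- x)"
  by (simp add: ecirc_eq_cis cis_cnj)

lemma ecirc_of_nat_mult: "ecirc (of_nat n * x) = ecirc x ^ n"
  by (simp add: ecirc_eq_cis Complex.DeMoivre mult_ac)

lemma continuous_on_ecirc [continuous_intros]:
  "continuous_on S f \<Longrightarrow> continuous_on S (\<lambda>x. ecirc (f x))"
  unfolding ecirc_def by (intro continuous_intros)

lemma has_vector_derivative_ecirc: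
  "((\<lambda>t. ecirc (c * t)) has_vector_derivative (2 * of_real (pi * c) * \<i>) * ecirc (c * t)) (at t within S)"
  unfolding ecirc_def
  by (rule has_vector_derivative_real_field derivative_eq_intros refl | simp)+

text \<open>A chord of the unit circle is no longer than the arc it spans.\<close>

lemma dist_ecirc_le: "cmod (ecirc x - ecirc y) \<le> 2 * pi * \<bar>x - y\<bar>"
proof -
  have "ecirc x - ecirc y = (ecirc (x - y) - 1) * ecirc y"
    using ecirc_add[of "x - y" y] by (simp add: algebra_simps)
  then have "cmod (ecirc x - ecirc y) = cmod (ecirc (x - y) - 1)"
    by (simp add: norm_mult)
  also have "\<dots> = 2 * \<bar>sin (pi * (x - y))\<bar>"
    using dist_exp_i_1[of "2 * pi * (x - y)"] by (simp add: ecirc_eq_cis cis_conv_exp)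
  also have "\<dots> \<le> 2 * \<bar>pi * (x - y)\<bar>"
    using abs_sin_x_le_abs_x by simp
  finally show ?thesis by (simp add: abs_mult)
qed

lemma ecirc_eq_iff: "ecirc x = ecirc y \<longleftrightarrow> (\<exists>n. x - y = of_int n)"
proof -
  have "ecirc x = ecirc y \<longleftrightarrow> ecirc (x - y) = 1"
    using ecirc_add[of "x - y" y] by auto (metis norm_ecirc norm_zero zero_neq_one)
  also have "\<dots> \<longleftrightarrow> (\<exists>n. x - y = of_int n)"
    unfolding ecirc_def exp_eq_1 by auto
  finally show ?thesis .
qed

lemma integral_ecirc:
  "integral {0..1} (\<lambda>t. ecirc (of_int h * t)) = (if h = 0 then 1 else 0)"
proof (cases "h = 0")
  case False
  have "((\<lambda>t. (2 * of_real (pi * of_int h) * \<i>) * ecirc (of_int h * t)) has_integral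
           (ecirc (of_int h * 1) - ecirc (of_int h * 0))) {0..1}"
    by (rule fundamental_theorem_of_calculus) (simp_all only: has_vector_derivative_ecirc zero_le_one)
  from has_integral_mult_right[OF this, of "1 / (2 * of_real (pi * of_int h) * \<i>)"] False
  have "((\<lambda>t. ecirc (of_int h * t)) has_integral 0) {0..1}" by simp
  then show ?thesis using False by (simp add: integral_unique)
qed simp


section \<open>The Fejer kernel and its decay away from the integers\<close>

lemma fejer_kernel_eq:
  "(\<Sum>j<N. \<Sum>k<N. ecirc (of_int (int j - int k) * u)) =
     complex_of_real ((cmod (\<Sum>k<N. ecirc (of_nat k * u)))\<^sup>2)"
proof -
  have "complex_of_real ((cmod (\<Sum>k<N. ecirc (of_nat k * u)))\<^sup>2) =
      (\<Sum>j<N. ecirc (of_nat j * u)) * cnj (\<Sum>k<N. ecirc (of_nat k * u))"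
    by (rule complex_norm_square)
  also have "\<dots> = (\<Sum>j<N. \<Sum>k<N. ecirc (of_int (int j - int k) * u))"
    by (simp add: sum_product cnj_ecirc left_diff_distrib' flip: ecirc_add)
  finally show ?thesis by simp
qed

text \<open>The geometric sum times \<open>ecirc u - 1\<close> telescopes to
  \<open>ecirc u ^ N - 1\<close>, of modulus at most 2. The bound is uniform in N, so the kernel,
  which carries a factor 1/N, times the squared chord is O(1/N).\<close>

lemma fejer_kernel_bound:
  "(cmod (\<Sum>k<N. ecirc (of_nat k * u)))\<^sup>2 * (cmod (ecirc u - 1))\<^sup>2 \<le> 4"
proof -
  have "(ecirc u - 1) * (\<Sum>k<N. ecirc (of_nat k * u)) = ecirc u ^ N - 1"
    by (simp add: ecirc_of_nat_mult power_diff_1_eq)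
  then have "cmod (ecirc u - 1) * cmod (\<Sum>k<N. ecirc (of_nat k * u)) = cmod (ecirc u ^ N - 1)"
    by (metis norm_mult)
  also have "\<dots> \<le> 2"
    using norm_triangle_ineq4[of "ecirc u ^ N" 1] by (simp add: norm_power)
  finally have "(cmod (ecirc u - 1) * cmod (\<Sum>k<N. ecirc (of_nat k * u)))\<^sup>2 \<le> 2\<^sup>2"
    by (intro power_mono) auto
  then show ?thesis by (simp add: power_mult_distrib mult.commute)
qed

text \<open>A modulus of continuity that is quadratic in the chord length: the chord squared cancels
  the singularity of the Fejer kernel, so no splitting of the integral is needed.\<close>
lemma circle_modulus:
  fixes g :: "real \<Rightarrow> complex"
  assumes g: "continuous_on {0..1} g" "g 0 = g 1" and "\<eta> > 0"
  shows "\<exists>C\<ge>0. \<forall>s\<in>{0..1}. \<forall>t\<in>{0..1}. cmod (g s - g t) \<le> \<eta> + C * (cmod (ecirc s - ecirc t))\<^sup>2"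
proof -
  \<comment> \<open>The pairs where g varies by at least \<eta> form a compact set. If the chord
    never vanishes there, its square has a positive minimum on it.\<close>
  define A where "A = {p \<in> {0..1} \<times> {0..1}. \<eta> \<le> cmod (g (fst p) - g (snd p))}"
  obtain B where B: "B > 0" "\<And>t. t \<in> {0..1} \<Longrightarrow> cmod (g t) \<le> B"
    using compact_imp_bounded[OF compact_continuous_image[OF g(1)]]
    unfolding bounded_pos by auto
  have gp: "continuous_on ({0..1} \<times> {0..1}) (\<lambda>p. g (fst p))"
           "continuous_on ({0..1} \<times> {0..1}) (\<lambda>p. g (snd p))"
    by (rule continuous_on_compose2[OF g(1)]; force intro!: continuous_intros)+
  have "closed A" unfolding A_def
    by (intro continuous_on_closed_Collect_le continuous_intros gp closed_Times closed_atLeastAtMost)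
  moreover have "bounded A"
    by (rule bounded_subset[of "{0..1} \<times> {0..1}"]) (auto simp: A_def intro!: bounded_Times)
  ultimately have "compact A"
    by (simp add: compact_eq_bounded_closed)
  show ?thesis
  proof (cases "A = {}")
    case True
    then show ?thesis
      by (intro exI[of _ 0]) (force simp: A_def)
  next
    case False
    define d where "d p = (cmod (ecirc (fst p) - ecirc (snd p)))\<^sup>2" for p :: "real \<times> real"
    have "continuous_on A d" unfolding d_def by (intro continuous_intros)
    then obtain p where p: "p \<in> A" "\<And>q. q \<in> A \<Longrightarrow> d p \<le> d q"
      using continuous_attains_inf[OF \<open>compact A\<close> False] by blast
    \<comment> \<open>A zero chord means parameters differing by an integer: equal points, or the
      two endpoints, where g agrees. Neither kind of pair lies in A.\<close>
    have "d p \<noteq> 0"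
    proof
      assume "d p = 0"
      then obtain n where n: "fst p - snd p = of_int n"
        by (auto simp: d_def ecirc_eq_iff)
      have fs: "fst p \<in> {0..1}" "snd p \<in> {0..1}" using p(1) by (auto simp: A_def)
      then have "of_int n \<le> (1::real)" "of_int n \<ge> (-1::real)" using n by auto
      then have "n = -1 \<or> n = 0 \<or> n = 1" by linarith
      then have "g (fst p) = g (snd p)"
      proof (elim disjE)
        assume "n = -1"
        then have "fst p = 0" "snd p = 1" using n fs by auto
        then show ?thesis using g(2) by simp
      next
        assume "n = 1"
        then have "fst p = 1" "snd p = 0" using n fs by auto
        then show ?thesis using g(2) by simp
      qed (use n in auto)
      then show False using p(1) \<open>\<eta> > 0\<close> by (auto simp: A_def)
    qed
    then have dp: "d p > 0" by (simp add: d_def)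
    show ?thesis
    \<comment> \<open>On A the difference is at most 2B while the squared chord is at least
      \<open>d p\<close>; off A the term \<eta> alone suffices.\<close>
    proof (intro exI[of _ "2 * B / d p"] conjI ballI)
      fix s t :: real assume st: "s \<in> {0..1}" "t \<in> {0..1}"
      show "cmod (g s - g t) \<le> \<eta> + 2 * B / d p * (cmod (ecirc s - ecirc t))\<^sup>2"
      proof (cases "(s, t) \<in> A")
        case True
        have "cmod (g s - g t) \<le> 2 * B"
          using norm_triangle_ineq4[of "g s" "g t"] B(2)[OF st(1)] B(2)[OF st(2)] by linarith
        also have "\<dots> = 2 * B / d p * d p" using dp by simp
        also have "\<dots> \<le> 2 * B / d p * d (s, t)"
          using p(2)[OF True] B dp by (intro mult_left_mono) auto
        finally show ?thesis using \<open>\<eta> > 0\<close> by (simp add: d_def)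
      next
        case False
        then have "cmod (g s - g t) \<le> \<eta>" using st by (auto simp: A_def)
        moreover have "0 \<le> 2 * B / d p * (cmod (ecirc s - ecirc t))\<^sup>2"
          using B dp by (intro mult_nonneg_nonneg) auto
        ultimately show ?thesis by linarith
      qed
    qed (use B dp in auto)
  qed
qed

text \<open>Written as a squared modulus instead of a quotient of sines: positivity is immediate and
  integer u need no special value.\<close>

definition fejer_kernel :: "nat \<Rightarrow> real \<Rightarrow> real" where
  "fejer_kernel N u = (cmod (\<Sum>k<N. ecirc (of_nat k * u)))\<^sup>2 / of_nat N"

lemma fejer_kernel_nonneg: "0 \<le> fejer_kernel N u"
  by (simp add: fejer_kernel_def)

text \<open>Convolution with the kernel is the Cesaro mean: expand the kernel into characters and
  split each \<open>ecirc\<close> of h(t - s) into a factor in s and a factor in t.\<close>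

lemma integral_fejer_kernel:
  fixes g :: "real \<Rightarrow> complex"
  assumes g: "continuous_on {0..1} g"
  shows "((\<lambda>s. g s * of_real (fejer_kernel N (t - s))) has_integral
    (\<Sum>j<N. \<Sum>k<N. fourier_coeff g (int j - int k) * ecirc (of_int (int j - int k) * t)) / of_nat N) {0..1}"
proof -
  have "((\<lambda>s. g s * ecirc (- (of_int h * s))) has_integral fourier_coeff g h) {0..1}" for h
    unfolding fourier_coeff_def
    by (intro integrable_integral integrable_continuous_real continuous_intros g)
  then have "((\<lambda>s. (\<Sum>j<N. \<Sum>k<N. g s * ecirc (- (of_int (int j - int k) * s)) * ecirc (of_int (int j - int k) * t)) / of_nat N)
      has_integral (\<Sum>j<N. \<Sum>k<N. fourier_coeff g (int j - int k) * ecirc (of_int (int j - int k) * t)) / of_nat N) {0..1}"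
    by (intro has_integral_divide has_integral_sum has_integral_mult_left finite_lessThan)
  moreover have "(\<Sum>j<N. \<Sum>k<N. g s * ecirc (- (of_int (int j - int k) * s)) * ecirc (of_int (int j - int k) * t)) / of_nat N
      = g s * of_real (fejer_kernel N (t - s))" for s
  proof -
    have "of_real (fejer_kernel N (t - s)) =
      (\<Sum>j<N. \<Sum>k<N. ecirc (of_int (int j - int k) * (t - s))) / of_nat N"
      unfolding fejer_kernel_eq fejer_kernel_def by simp
    also have "\<dots> = (\<Sum>j<N. \<Sum>k<N. ecirc (- (of_int (int j - int k) * s)) * ecirc (of_int (int j - int k) * t)) / of_nat N"
      unfolding ecirc_add[symmetric]
      by (intro arg_cong2[where f = "(/)"] sum.cong refl arg_cong[where f = ecirc]) (simp add: algebra_simps)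
    finally show ?thesis
      by (simp add: sum_distrib_left mult.assoc)
  qed
  ultimately show ?thesis by simp
qed

lemma fourier_coeff_1: "fourier_coeff (\<lambda>_. 1) h = (if h = 0 then 1 else 0)"
  using integral_ecirc[of "- h"] by (simp add: fourier_coeff_def)

text \<open>The convolution formula for the constant 1, where only the N diagonal terms j = k
  survive.\<close>

lemma fejer_kernel_has_integral_1:
  assumes "N > 0"
  shows "((\<lambda>s. fejer_kernel N (t - s)) has_integral 1) {0..1}"
proof -
  have "((\<lambda>s. 1 * complex_of_real (fejer_kernel N (t - s))) has_integral 1) {0..1}"
    using integral_fejer_kernel[of "\<lambda>_. 1" N t] assms
    by (simp add: fourier_coeff_1 if_distrib[of "\<lambda>x. x * _"] cong: if_cong)
  from has_integral_Re[OF this] show ?thesis by simp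
qed

text \<open>Group the pairs (j, k) by their difference h. Given h, the first entry determines the
  second, so each group has at most N members and its share of N is a weight in [0,1].\<close>

lemma cesaro_weights:
  assumes "N > 0"
  obtains w :: "int \<Rightarrow> real" where "\<And>h. 0 \<le> w h" "\<And>h. w h \<le> 1"
    "\<And>\<phi> :: int \<Rightarrow> complex. (\<Sum>j<N. \<Sum>k<N. \<phi> (int j - int k)) / of_nat N = (\<Sum>h\<in>{-int N..int N}. of_real (w h) * \<phi> h)"
proof
  define S where "S h = {p \<in> {..<N} \<times> {..<N}. int (fst p) - int (snd p) = h}" for h
  define w where "w h = real (card (S h)) / N" for h
  show "0 \<le> w h" for h by (simp add: w_def)
  show "w h \<le> 1" for h
  proof -
    have "card (S h) \<le> card {..<N}"
      by (rule card_inj_on_le[of fst]) (auto simp: S_def inj_on_def)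
    then show ?thesis using assms by (simp add: w_def)
  qed
  fix \<phi> :: "int \<Rightarrow> complex"
  have "(\<Sum>j<N. \<Sum>k<N. \<phi> (int j - int k)) = (\<Sum>p\<in>{..<N} \<times> {..<N}. \<phi> (int (fst p) - int (snd p)))"
    by (simp add: sum.cartesian_product case_prod_unfold)
  also have "\<dots> = (\<Sum>h\<in>{-int N..int N}. \<Sum>p\<in>S h. \<phi> (int (fst p) - int (snd p)))"
    unfolding S_def by (rule sum.group[symmetric]) auto
  also have "\<dots> = (\<Sum>h\<in>{-int N..int N}. of_nat (card (S h)) * \<phi> h)"
    by (intro sum.cong refl) (simp add: S_def)
  finally show "(\<Sum>j<N. \<Sum>k<N. \<phi> (int j - int k)) / of_nat N = (\<Sum>h\<in>{-int N..int N}. of_real (w h) * \<phi> h)"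
    by (simp add: w_def sum_divide_distrib)
qed

theorem fejer_approx:
  fixes g :: "real \<Rightarrow> complex"
  assumes g: "continuous_on {0..1} g" "g 0 = g 1" and "\<epsilon> > 0"
  obtains N and w :: "int \<Rightarrow> real" where "\<And>h. 0 \<le> w h" "\<And>h. w h \<le> 1"
    "\<And>t. t \<in> {0..1} \<Longrightarrow>
       cmod ((\<Sum>h\<in>{-int N..int N}. of_real (w h) * (fourier_coeff g h * ecirc (of_int h * t))) - g t) < \<epsilon>"
proof -
  obtain C where C: "C \<ge> 0"
    "\<And>s t. s \<in> {0..1} \<Longrightarrow> t \<in> {0..1} \<Longrightarrow> cmod (g s - g t) \<le> \<epsilon> / 2 + C * (cmod (ecirc s - ecirc t))\<^sup>2"
    using circle_modulus[OF g, of "\<epsilon> / 2"] \<open>\<epsilon> > 0\<close> by auto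
  obtain N :: nat where N: "N > 0" "4 * C / N < \<epsilon> / 2"
  proof -
    obtain n where "8 * C / \<epsilon> < of_nat n" using reals_Archimedean2 by blast
    then have "4 * C / real (Suc n) < \<epsilon> / 2" using \<open>\<epsilon> > 0\<close> C by (simp add: field_simps)
    then show ?thesis using that by blast
  qed
  obtain w :: "int \<Rightarrow> real" where w: "\<And>h. 0 \<le> w h" "\<And>h. w h \<le> 1"
    "\<And>\<phi>. (\<Sum>j<N. \<Sum>k<N. \<phi> (int j - int k)) / of_nat N = (\<Sum>h\<in>{-int N..int N}. complex_of_real (w h) * \<phi> h)"
    using cesaro_weights[OF N(1)] by blast
  define \<sigma> where "\<sigma> t = (\<Sum>j<N. \<Sum>k<N. fourier_coeff g (int j - int k) * ecirc (of_int (int j - int k) * t)) / of_nat N" for t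
  have bound: "cmod (\<sigma> t - g t) < \<epsilon>" if t: "t \<in> {0..1}" for t
  proof -
    let ?F = "\<lambda>s. fejer_kernel N (t - s)"
    have 1: "((\<lambda>s. g s * of_real (?F s) - g t * of_real (?F s)) has_integral \<sigma> t - g t * of_real 1) {0..1}"
      unfolding \<sigma>_def
      by (intro has_integral_diff integral_fejer_kernel g has_integral_mult_right
           has_integral_of_real fejer_kernel_has_integral_1 N)
    have 2: "((\<lambda>s. \<epsilon> / 2 * ?F s + 4 * C / N) has_integral \<epsilon> / 2 * 1 + 4 * C / N) {0..1}"
      using has_integral_const_real[of "4 * C / N" 0 1]
      by (intro has_integral_add has_integral_mult_right fejer_kernel_has_integral_1 N) simp
    \<comment> \<open>The chord from s to t has length \<open>cmod (ecirc (t - s) - 1)\<close>, so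
      the quadratic part of the modulus cancels against the kernel up to 4/N. The constant part
      integrates to \<epsilon>/2 because the kernel has mass 1.\<close>
    have pw: "cmod (g s * of_real (?F s) - g t * of_real (?F s)) \<le> \<epsilon> / 2 * ?F s + 4 * C / N"
      if s: "s \<in> {0..1}" for s
    proof -
      have eq: "ecirc s - ecirc t = - (ecirc (t - s) - 1) * ecirc s"
        using ecirc_add[of "t - s" s] by (simp add: algebra_simps)
      have "cmod (g s * of_real (?F s) - g t * of_real (?F s)) = cmod ((g s - g t) * of_real (?F s))"
        by (simp add: left_diff_distrib)
      also have "\<dots> = cmod (g s - g t) * ?F s"
        by (simp add: norm_mult fejer_kernel_nonneg)
      also have "\<dots> \<le> (\<epsilon> / 2 + C * (cmod (ecirc s - ecirc t))\<^sup>2) * ?F s"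
        by (intro mult_right_mono C s t fejer_kernel_nonneg)
      also have "\<dots> = \<epsilon> / 2 * ?F s + C * ((cmod (ecirc s - ecirc t))\<^sup>2 * ?F s)"
        by (simp add: algebra_simps)
      also have "(cmod (ecirc s - ecirc t))\<^sup>2 * ?F s \<le> 4 / N"
        using fejer_kernel_bound[of "t - s" N] N
        unfolding eq norm_mult norm_minus_cancel norm_ecirc fejer_kernel_def
        by (simp add: field_simps)
      finally show ?thesis using C by (simp add: mult_left_mono)
    qed
    have "cmod (\<sigma> t - g t * of_real 1) \<le> \<epsilon> / 2 * 1 + 4 * C / N"
      using has_integral_norm_bound_integral_component[OF 1 2, of 1] pw by simp
    then show ?thesis using N by simp
  qed
  show ?thesis
  proof (rule that)
    fix t :: real assume t: "t \<in> {0..1}"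
    have "\<sigma> t = (\<Sum>h\<in>{-int N..int N}. of_real (w h) * (fourier_coeff g h * ecirc (of_int h * t)))"
      unfolding \<sigma>_def using w(3)[of "\<lambda>h. fourier_coeff g h * ecirc (of_int h * t)"] by simp
    with bound[OF t] show "cmod ((\<Sum>h\<in>{-int N..int N}. of_real (w h) * (fourier_coeff g h * ecirc (of_int h * t))) - g t) < \<epsilon>"
      by simp
  qed (use w in auto)
qed

section \<open>Functions approximable by trigonometric polynomials with coefficients in [-2,2]\<close>

text \<open>For h \<noteq> 0 this is the integral of e(hs) over s from 0 to t. At h = 0 division by
  zero makes it 0, so the linear term has to be added separately.\<close>

definition kterm :: "int \<Rightarrow> real \<Rightarrow> complex" where
  "kterm h t = (ecirc (of_int h * t) - 1) / (2 * of_real pi * \<i> * of_int h)"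

text \<open>\<open>K_partial\<close> for a deterministic coefficient sequence, so that the analysis
  can be done for one sample at a time.\<close>

definition kpoly :: "(int \<Rightarrow> real) \<Rightarrow> nat \<Rightarrow> real \<Rightarrow> complex" where
  "kpoly y N t = of_real t * of_real (y 0) + (\<Sum>h\<in>{-int N..int N} - {0}. kterm h t * of_real (y h))"

lemma K_partial_eq_kpoly: "K_partial ST N \<omega> = kpoly (\<lambda>h. ST h \<omega>) N"
  by (simp add: fun_eq_iff K_partial_def kpoly_def kterm_def)

lemma continuous_on_kterm [continuous_intros]: "continuous_on S (kterm h)"
  unfolding kterm_def divide_inverse by (intro continuous_intros)

lemma continuous_on_kpoly [continuous_intros]: "continuous_on S (kpoly y N)"
  unfolding kpoly_def by (intro continuous_intros)

lemma kterm_at_0 [simp]: "kterm h 0 = 0" and kterm_at_1 [simp]: "kterm h 1 = 0"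
  by (simp_all add: kterm_def)

lemma kpoly_at_0: "kpoly y N 0 = 0" and kpoly_at_1: "kpoly y N 1 = of_real (y 0)"
  by (simp_all add: kpoly_def)

lemma norm_kterm_le: "cmod (kterm h t) \<le> 1"
proof (cases "h = 0")
  case False
  have "cmod (kterm h t) = cmod (ecirc (of_int h * t) - 1) / (2 * pi * \<bar>of_int h\<bar>)"
    by (simp add: kterm_def norm_divide norm_mult)
  also have "\<dots> \<le> 2 / (2 * pi * \<bar>of_int h\<bar>)"
    using norm_triangle_ineq4[of "ecirc (of_int h * t)" 1] by (intro divide_right_mono) auto
  also have "\<dots> \<le> 1"
  proof -
    have "1 * 1 \<le> pi * \<bar>of_int h\<bar>"
      using False pi_gt3 by (intro mult_mono) auto
    then show ?thesis by simp
  qed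
  finally show ?thesis .
qed (simp add: kterm_def)

text \<open>Orthogonality of characters: the constant -1 in \<open>kterm\<close> only reaches
  frequency 0, which h \<noteq> 0 excludes. For k = 0 both sides are 0 through division by
  zero.\<close>

lemma has_integral_kterm_ecirc:
  assumes "h \<noteq> 0"
  shows "((\<lambda>t. kterm k t * ecirc (- (of_int h * t))) has_integral
           (if k = h then 1 / (2 * of_real pi * \<i> * of_int h) else 0)) {0..1}"
proof -
  have e: "((\<lambda>t. ecirc (of_int m * t)) has_integral (if m = 0 then 1 else 0)) {0..1}" for m
    unfolding integral_ecirc[symmetric]
    by (intro integrable_integral integrable_continuous_real continuous_intros)
  have "((\<lambda>t. (ecirc (of_int (k - h) * t) - ecirc (of_int (- h) * t)) / (2 * of_real pi * \<i> * of_int k))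
      has_integral ((if k - h = 0 then 1 else 0) - (if - h = 0 then 1 else 0)) / (2 * of_real pi * \<i> * of_int k)) {0..1}"
    by (intro has_integral_divide has_integral_diff e)
  moreover have "kterm k t * ecirc (- (of_int h * t)) =
      (ecirc (of_int (k - h) * t) - ecirc (of_int (- h) * t)) / (2 * of_real pi * \<i> * of_int k)" for t
  proof -
    have "ecirc (of_int (k - h) * t) = ecirc (of_int k * t) * ecirc (- (of_int h * t))"
      by (simp add: algebra_simps flip: ecirc_add)
    then show ?thesis by (simp add: kterm_def left_diff_distrib)
  qed
  moreover have "((if k - h = 0 then 1 else 0) - (if - h = 0 then 1 else 0)) / (2 * of_real pi * \<i> * of_int k) =
      (if k = h then 1 / (2 * of_real pi * \<i> * of_int h) else (0::complex))"
    using assms by simp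
  ultimately show ?thesis by (simp only:)
qed

lemma fourier_coeff_kpoly:
  assumes "h \<noteq> 0"
  shows "fourier_coeff (\<lambda>t. kpoly y N t - of_real t * kpoly y N 1) h =
    (if \<bar>h\<bar> \<le> int N then of_real (y h) / (2 * of_real pi * \<i> * of_int h) else 0)"
proof -
  have "((\<lambda>t. \<Sum>k\<in>{-int N..int N} - {0}. of_real (y k) * (kterm k t * ecirc (- (of_int h * t)))) has_integral
     (\<Sum>k\<in>{-int N..int N} - {0}. of_real (y k) * (if k = h then 1 / (2 * of_real pi * \<i> * of_int h) else 0))) {0..1}"
    by (intro has_integral_sum has_integral_mult_right has_integral_kterm_ecirc assms) auto
  also have "(\<lambda>t. \<Sum>k\<in>{-int N..int N} - {0}. of_real (y k) * (kterm k t * ecirc (- (of_int h * t)))) =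
     (\<lambda>t. (kpoly y N t - of_real t * kpoly y N 1) * ecirc (- (of_int h * t)))"
    unfolding kpoly_at_1 unfolding kpoly_def by (simp add: sum_distrib_left mult_ac)
  also have "(\<Sum>k\<in>{-int N..int N} - {0}. of_real (y k) * (if k = h then 1 / (2 * of_real pi * \<i> * of_int h) else 0)) =
    (if \<bar>h\<bar> \<le> int N then of_real (y h) / (2 * of_real pi * \<i> * of_int h) else 0)"
    using assms by (auto simp: if_distrib[of "\<lambda>x. _ * x"] cong: if_cong)
  finally show ?thesis
    unfolding fourier_coeff_def by (rule integral_unique)
qed

text \<open>Characters have modulus 1, so each coefficient is 1-Lipschitz in the sup norm. This
  makes conditions on coefficients pass to uniform limits.\<close>

lemma norm_fourier_coeff_diff_le:
  assumes "continuous_on {0..1} f" "continuous_on {0..1} g"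
    and "\<And>t. t \<in> {0..1} \<Longrightarrow> cmod (f t - g t) \<le> B"
  shows "cmod (fourier_coeff f h - fourier_coeff g h) \<le> B"
proof -
  have "fourier_coeff f h - fourier_coeff g h =
     integral {0..1} (\<lambda>t. (f t - g t) * ecirc (- (of_int h * t)))"
    unfolding fourier_coeff_def left_diff_distrib
    by (intro integral_diff[symmetric] integrable_continuous_real continuous_intros assms)
  also have "cmod \<dots> \<le> B * (1 - 0)"
    by (intro integral_bound continuous_intros assms) (auto simp: norm_mult assms(3))
  finally show ?thesis by simp
qed

lemma kpoly_closure_imp_fourier:
  assumes f: "continuous_on {0..1} f"
    and approx: "\<And>\<epsilon>. \<epsilon> > 0 \<Longrightarrow> \<exists>y N. (\<forall>h. \<bar>y h\<bar> \<le> 2) \<and> (\<forall>t\<in>{0..1}. cmod (kpoly y N t - f t) < \<epsilon>)"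
  shows "f 0 = 0" "f 1 \<in> complex_of_real ` {-2..2}"
    and "h \<noteq> 0 \<Longrightarrow> Re (fourier_coeff (\<lambda>t. f t - of_real t * f 1) h) = 0"
    and "h \<noteq> 0 \<Longrightarrow> cmod (fourier_coeff (\<lambda>t. f t - of_real t * f 1) h) \<le> 1 / (pi * real_of_int \<bar>h\<bar>)"
proof -
  have "f 0 \<in> {0}"
  proof (rule iffD1[OF closed_approachable], simp, intro allI impI)
    fix \<epsilon> :: real assume "\<epsilon> > 0"
    from approx[OF this] show "\<exists>z\<in>{0}. dist z (f 0) < \<epsilon>"
      by (metis atLeastAtMost_iff dist_norm insertI1 kpoly_at_0 order_refl zero_le_one)
  qed
  then show "f 0 = 0" by simp
  show "f 1 \<in> complex_of_real ` {-2..2}"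
  proof (rule iffD1[OF closed_approachable], goal_cases)
    case 1
    then show ?case
      by (intro compact_imp_closed compact_continuous_image continuous_intros) simp
  next
    case 2
    show ?case
    proof (intro allI impI)
      fix \<epsilon> :: real assume "\<epsilon> > 0"
      from approx[OF this] obtain y N where y: "\<forall>h. \<bar>y h\<bar> \<le> 2" "cmod (kpoly y N 1 - f 1) < \<epsilon>"
        by fastforce
      moreover have "y 0 \<in> {-2..2}" using y(1) by (auto simp: abs_le_iff minus_le_iff)
      ultimately show "\<exists>z\<in>complex_of_real ` {-2..2}. dist z (f 1) < \<epsilon>"
        by (auto simp: kpoly_at_1 dist_norm)
    qed
  qed
  \<comment> \<open>Both conditions on the coefficient at h as membership in one closed set.\<close>
  define Z where "Z = {z. Re z = 0} \<inter> cball 0 (1 / (pi * real_of_int \<bar>h\<bar>))"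
  have "fourier_coeff (\<lambda>t. f t - of_real t * f 1) h \<in> Z" if h: "h \<noteq> 0"
  proof (rule iffD1[OF closed_approachable], goal_cases)
    case 1
    show ?case unfolding Z_def
      by (intro closed_Int closed_cball closed_Collect_eq continuous_intros)
  next
    case 2
    show ?case
    proof (intro allI impI)
      fix \<epsilon> :: real assume "\<epsilon> > 0"
      \<comment> \<open>Subtracting t times the value at 1 at most doubles the uniform error, so
        \<epsilon>/3 becomes 2\<epsilon>/3.\<close>
      then have "\<epsilon> / 3 > 0" by simp
      from approx[OF this] obtain y N where
        y: "\<forall>h. \<bar>y h\<bar> \<le> 2" "\<And>t. t \<in> {0..1} \<Longrightarrow> cmod (kpoly y N t - f t) < \<epsilon> / 3"
        by blast
      let ?c = "fourier_coeff (\<lambda>t. kpoly y N t - of_real t * kpoly y N 1) h"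
      have "?c \<in> Z"
      proof -
        have "\<bar>y h\<bar> / (2 * pi * \<bar>of_int h\<bar>) \<le> 2 / (2 * pi * \<bar>of_int h\<bar>)"
          using y(1) by (intro divide_right_mono) auto
        then show ?thesis
          by (auto simp: fourier_coeff_kpoly[OF h] Z_def norm_divide norm_mult Re_divide)
      qed
      moreover have "dist ?c (fourier_coeff (\<lambda>t. f t - of_real t * f 1) h) \<le> 2 * \<epsilon> / 3"
        unfolding dist_norm
      proof (rule norm_fourier_coeff_diff_le)
        fix t :: real assume t: "t \<in> {0..1}"
        have "(kpoly y N t - of_real t * kpoly y N 1) - (f t - of_real t * f 1)
           = (kpoly y N t - f t) - of_real t * (kpoly y N 1 - f 1)"
          by (simp add: algebra_simps)
        also have "cmod \<dots> \<le> cmod (kpoly y N t - f t) + cmod (of_real t * (kpoly y N 1 - f 1))"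
          by (rule norm_triangle_ineq4)
        also have "cmod (of_real t * (kpoly y N 1 - f 1)) \<le> 1 * cmod (kpoly y N 1 - f 1)"
          unfolding norm_mult using t by (intro mult_right_mono) auto
        finally show "cmod ((kpoly y N t - of_real t * kpoly y N 1) - (f t - of_real t * f 1)) \<le> 2 * \<epsilon> / 3"
          using y(2)[OF t] y(2)[of 1] by simp
      qed (intro continuous_intros f)+
      ultimately show "\<exists>z\<in>Z. dist z (fourier_coeff (\<lambda>t. f t - of_real t * f 1) h) < \<epsilon>"
        using \<open>\<epsilon> > 0\<close> by (intro bexI[of _ ?c]) auto
    qed
  qed
  then show "h \<noteq> 0 \<Longrightarrow> Re (fourier_coeff (\<lambda>t. f t - of_real t * f 1) h) = 0"
    "h \<noteq> 0 \<Longrightarrow> cmod (fourier_coeff (\<lambda>t. f t - of_real t * f 1) h) \<le> 1 / (pi * real_of_int \<bar>h\<bar>)"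
    by (auto simp: Z_def)
qed

lemma fourier_imp_kpoly_closure:
  assumes f: "continuous_on {0..1} f" "f 0 = 0" "f 1 \<in> complex_of_real ` {-2..2}"
    and coeff: "\<And>h. h \<noteq> 0 \<Longrightarrow> Re (fourier_coeff (\<lambda>t. f t - of_real t * f 1) h) = 0"
      "\<And>h. h \<noteq> 0 \<Longrightarrow> cmod (fourier_coeff (\<lambda>t. f t - of_real t * f 1) h) \<le> 1 / (pi * real_of_int \<bar>h\<bar>)"
    and "\<epsilon> > 0"
  obtains y N where "\<And>h. \<bar>y h\<bar> \<le> 2" "\<And>t. t \<in> {0..1} \<Longrightarrow> cmod (kpoly y N t - f t) < \<epsilon>"
proof -
  define g where "g t = f t - of_real t * f 1" for t
  define c where "c = fourier_coeff g"
  have g: "continuous_on {0..1} g" "g 0 = 0" "g 1 = 0"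
    unfolding g_def by (auto intro!: continuous_intros f simp: f(2))
  have g01: "g 0 = g 1" and "\<epsilon> / 2 > 0"
    using g \<open>\<epsilon> > 0\<close> by auto
  obtain N w where w: "\<And>h. 0 \<le> w h" "\<And>h. w h \<le> 1"
    "\<And>t. t \<in> {0..1} \<Longrightarrow>
       cmod ((\<Sum>h\<in>{-int N..int N}. of_real (w h) * (c h * ecirc (of_int h * t))) - g t) < \<epsilon> / 2"
    unfolding c_def by (rule fejer_approx[OF g(1) g01 \<open>\<epsilon> / 2 > 0\<close>]) blast
  \<comment> \<open>Inverts \<open>fourier_coeff_kpoly\<close>: c = y/(2 pi i h) gives y = 2 pi i h
    c, which for imaginary c is the real number -2 pi h Im c. The Fejer weight multiplies it; the
    linear coefficient is f(1) itself.\<close>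
  define y where "y h = (if h = 0 then Re (f 1) else w h * (- 2 * pi * of_int h * Im (c h)))" for h
  have f1: "\<bar>Re (f 1)\<bar> \<le> 2" "of_real (Re (f 1)) = f 1"
    using f(3) by auto
  show ?thesis
  proof (rule that)
    show "\<bar>y h\<bar> \<le> 2" for h
    proof (cases "h = 0")
      case True
      then show ?thesis using f1 by (simp add: y_def)
    next
      case False
      have "\<bar>Im (c h)\<bar> \<le> 1 / (pi * \<bar>of_int h\<bar>)"
        using abs_Im_le_cmod[of "c h"] coeff(2)[OF False] by (simp add: c_def g_def[abs_def])
      then have "2 * pi * \<bar>of_int h\<bar> * \<bar>Im (c h)\<bar> \<le> 2"
        using False by (simp add: field_simps)
      then have "w h * (2 * pi * \<bar>of_int h\<bar> * \<bar>Im (c h)\<bar>) \<le> 1 * 2"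
        using w by (intro mult_mono) auto
      then show ?thesis using False w(1)[of h] by (simp add: y_def abs_mult)
    qed
    fix t :: real assume t: "t \<in> {0..1}"
    let ?P = "\<lambda>t. \<Sum>h\<in>{-int N..int N}. of_real (w h) * (c h * ecirc (of_int h * t))"
    have "kpoly y N t = of_real t * f 1 + (\<Sum>h\<in>{-int N..int N} - {0}. of_real (w h) * (c h * (ecirc (of_int h * t) - 1)))"
      unfolding kpoly_def
    proof (intro arg_cong2[where f = "(+)"] sum.cong refl)
      fix h assume "h \<in> {-int N..int N} - {0}"
      then have h: "h \<noteq> 0" by auto
      have "c h = \<i> * of_real (Im (c h))"
        using coeff(1)[OF h] by (simp add: complex_eq_iff c_def g_def[abs_def])
      then have "of_real (y h) = of_real (w h) * (2 * of_real pi * \<i> * of_int h) * c h"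
        using h by (simp add: y_def complex_eq_iff)
      then show "kterm h t * of_real (y h) = of_real (w h) * (c h * (ecirc (of_int h * t) - 1))"
        using h by (simp add: kterm_def field_simps)
    qed (simp add: y_def f1)
    also have "(\<Sum>h\<in>{-int N..int N} - {0}. of_real (w h) * (c h * (ecirc (of_int h * t) - 1)))
      = (\<Sum>h\<in>{-int N..int N}. of_real (w h) * (c h * (ecirc (of_int h * t) - 1)))"
      by (rule sum.mono_neutral_left) auto
    \<comment> \<open>The terms of \<open>kpoly\<close> vanish at 0, so it reproduces the Fejer sum
      minus its value at 0. The approximation error thus enters twice, which is why \<epsilon>/2 was
      requested.\<close>
    also have "\<dots> = ?P t - ?P 0"
      by (simp add: right_diff_distrib sum_subtractf)
    finally have "kpoly y N t - f t = (?P t - g t) - (?P 0 - g 0)"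
      by (simp add: g_def f(2))
    also have "cmod \<dots> \<le> cmod (?P t - g t) + cmod (?P 0 - g 0)"
      by (rule norm_triangle_ineq4)
    also have "\<dots> < \<epsilon>"
      using w(3)[OF t] w(3)[of 0] by simp
    finally show "cmod (kpoly y N t - f t) < \<epsilon>" .
  qed
qed

section \<open>Uniform convergence from bounds on a net\<close>

text \<open>Summation by parts leaves a boundary term D_N/N of order N^(-1/4) and a series with
  terms D_n/(n(n+1)) of order n^(-5/4), which the Weierstrass test handles.\<close>

lemma uniform_limit_abel_sum:
  fixes D :: "nat \<Rightarrow> 'a \<Rightarrow> complex"
  assumes D0: "\<And>n t. n \<le> M \<Longrightarrow> D n t = 0"
    and D: "\<And>n t. t \<in> S \<Longrightarrow> cmod (D n t) \<le> C * real n powr (3/4)" and C: "C \<ge> 0"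
  obtains g where
    "uniform_limit S (\<lambda>N t. \<Sum>n<N. (D (Suc n) t - D n t) / of_nat (Suc n)) g sequentially"
    "\<And>t. t \<in> S \<Longrightarrow> cmod (g t) \<le> C * (\<Sum>n. real (n + M) powr (-5/4))"
proof -
  \<comment> \<open>The quotients with denominator 0 are harmless, since division by zero gives 0
    and D vanishes at index 0.\<close>
  have abel: "(\<Sum>n<N. (D (Suc n) t - D n t) / of_nat (Suc n)) =
      D N t / of_nat N + (\<Sum>n<N. D n t / (of_nat n * of_nat (Suc n)))" for N t
  proof (induction N)
    case (Suc N)
    have "D N t / of_nat N - D N t / of_nat (Suc N) = D N t / (of_nat N * of_nat (Suc N))"
    proof (cases "N = 0")
      case False
      then have "D N t / of_nat N - D N t / of_nat (Suc N) =
          (D N t * of_nat (Suc N) - D N t * of_nat N) / (of_nat N * of_nat (Suc N))"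
        by (intro diff_frac_eq) (simp_all del: of_nat_Suc)
      then show ?thesis by (simp add: algebra_simps)
    qed (simp add: D0)
    then show ?case
      unfolding sum.lessThan_Suc Suc.IH diff_divide_distrib[of "D (Suc N) t"]
      by (simp add: algebra_simps del: of_nat_Suc)
  qed simp
  \<comment> \<open>Being 0 below M, the majorant sums to exactly the tail from M on, as the final
    bound demands.\<close>
  define b where "b n = (if n < M then 0 else C * real n powr (-5/4))" for n
  have p: "summable (\<lambda>n. real n powr (-5/4))"
    by (subst summable_real_powr_iff) simp
  have "summable b"
    by (rule summable_comparison_test[OF _ summable_mult[OF p, of C]]) (use C in \<open>auto simp: b_def\<close>)
  have term_le: "cmod (D n t / (of_nat n * of_nat (Suc n))) \<le> b n" if "t \<in> S" for n t
  proof (cases "n \<le> M \<or> n = 0")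
    case True
    then show ?thesis using C D0[of n t] D0[of 0 t] by (auto simp: b_def)
  next
    case False
    then have n: "real n > 0" by auto
    have "cmod (D n t / (of_nat n * of_nat (Suc n))) = cmod (D n t) / (real n * real (Suc n))"
      by (simp add: norm_divide norm_mult del: of_nat_Suc)
    also have "\<dots> \<le> (C * real n powr (3/4)) / (real n * real n)"
      using D[OF that] C n by (intro frac_le mult_left_mono) auto
    also have "\<dots> = C * (real n powr (3/4) / real n powr 2)"
      using n by (simp add: power2_eq_square)
    also have "\<dots> = C * real n powr (-5/4)"
      unfolding powr_diff[symmetric] by simp
    finally show ?thesis using False by (simp add: b_def)
  qed
  define g where "g t = (\<Sum>n. D n t / (of_nat n * of_nat (Suc n)))" for t
  have 1: "uniform_limit S (\<lambda>N t. \<Sum>n<N. D n t / (of_nat n * of_nat (Suc n))) g sequentially"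
    unfolding g_def using term_le \<open>summable b\<close> by (rule Weierstrass_m_test)
  have 2: "uniform_limit S (\<lambda>N t. D N t / of_nat N) (\<lambda>_. 0) sequentially"
  proof (rule uniform_limitI)
    fix e :: real assume "e > 0"
    have "(\<lambda>N. C * real N powr (-1/4)) \<longlonglongrightarrow> C * 0"
      by (intro tendsto_mult tendsto_const tendsto_neg_powr filterlim_real_sequentially) simp
    then have "\<forall>\<^sub>F N in sequentially. C * real N powr (-1/4) < e"
      using \<open>e > 0\<close> by (simp add: order_tendstoD)
    then show "\<forall>\<^sub>F N in sequentially. \<forall>t\<in>S. dist (D N t / of_nat N) 0 < e"
      using eventually_gt_at_top[of 0]
    proof eventually_elim
      case (elim N)
      show ?case
      proof
        fix t assume "t \<in> S"
        have "dist (D N t / of_nat N) 0 = cmod (D N t) / real N"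
          by (simp add: norm_divide)
        also have "\<dots> \<le> C * real N powr (3/4) / real N powr 1"
          using D[OF \<open>t \<in> S\<close>, of N] elim by (auto intro: divide_right_mono)
        also have "\<dots> = C * real N powr (-1/4)"
          unfolding times_divide_eq_right[symmetric] powr_diff[symmetric] by simp
        finally show "dist (D N t / of_nat N) 0 < e" using elim by simp
      qed
    qed
  qed
  show ?thesis
  proof
    show "uniform_limit S (\<lambda>N t. \<Sum>n<N. (D (Suc n) t - D n t) / of_nat (Suc n)) g sequentially"
      unfolding abel using uniform_limit_add[OF 2 1] by simp
    fix t assume "t \<in> S"
    have "cmod (g t) \<le> (\<Sum>n. b n)"
      unfolding g_def
      by (rule norm_suminf_le[OF term_le[OF \<open>t \<in> S\<close>] \<open>summable b\<close>])
    also have "\<dots> = (\<Sum>n. b (n + M)) + (\<Sum>n<M. b n)"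
      by (rule suminf_split_initial_segment[OF \<open>summable b\<close>])
    also have "\<dots> = (\<Sum>n. C * real (n + M) powr (-5/4))"
      by (simp add: b_def)
    also have "\<dots> = C * (\<Sum>n. real (n + M) powr (-5/4))"
      by (rule suminf_mult[OF summable_ignore_initial_segment[OF p]])
    finally show "cmod (g t) \<le> C * (\<Sum>n. real (n + M) powr (-5/4))" .
  qed
qed

section \<open>Undamped sums over shells of frequencies, controlled on a grid\<close>

text \<open>\<open>dterm\<close> is \<open>kterm\<close> without the decay \<open>1/\<bar>h\<bar>\<close>, which Abel summation puts back.\<close>
definition shell :: "nat \<Rightarrow> nat \<Rightarrow> int set" where
  "shell M n = {h. int M < \<bar>h\<bar> \<and> \<bar>h\<bar> \<le> int n}"

definition dterm :: "int \<Rightarrow> real \<Rightarrow> complex" where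
  "dterm h t = of_int \<bar>h\<bar> * kterm h t"

definition dpoly :: "(int \<Rightarrow> real) \<Rightarrow> nat \<Rightarrow> nat \<Rightarrow> real \<Rightarrow> complex" where
  "dpoly y M n t = (\<Sum>h\<in>shell M n. dterm h t * of_real (y h))"

lemma finite_shell [simp]: "finite (shell M n)"
  by (rule finite_subset[of _ "{-int n..int n}"]) (auto simp: shell_def)

lemma card_shell_le: "card (shell M n) \<le> 2 * n"
proof -
  have "card (shell M n) \<le> card ({-int n..-1} \<union> {1..int n})"
    by (rule card_mono) (auto simp: shell_def)
  also have "\<dots> \<le> card {-int n..-1} + card {1..int n}"
    by (rule card_Un_le)
  finally show ?thesis by simp
qed

lemma dterm_diff: "cmod (dterm h t - dterm h s) = cmod (ecirc (of_int h * t) - ecirc (of_int h * s)) / (2 * pi)" if "h \<noteq> 0"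
proof -
  have "dterm h t - dterm h s =
      (ecirc (of_int h * t) - ecirc (of_int h * s)) * (of_int \<bar>h\<bar> / (2 * of_real pi * \<i> * of_int h))"
    by (simp add: dterm_def kterm_def diff_divide_distrib algebra_simps)
  then show ?thesis using that
    by (simp add: norm_mult norm_divide)
qed

lemma norm_dterm_le: "cmod (dterm h t) \<le> 1"
proof (cases "h = 0")
  case False
  have "cmod (dterm h t - dterm h 0) \<le> 2 / (2 * pi)"
    unfolding dterm_diff[OF False]
    using norm_triangle_ineq4[of "ecirc (of_int h * t)" "ecirc (of_int h * 0)"]
    by (intro divide_right_mono) auto
  also have "\<dots> \<le> 1" using pi_gt3 by simp
  finally show ?thesis by (simp add: dterm_def)
qed (simp add: dterm_def)

lemma norm_dterm_diff_le: "cmod (dterm h t - dterm h s) \<le> \<bar>of_int h\<bar> * \<bar>t - s\<bar>"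
proof (cases "h = 0")
  case False
  have "cmod (ecirc (of_int h * t) - ecirc (of_int h * s)) / (2 * pi) \<le> (2 * pi * \<bar>of_int h * t - of_int h * s\<bar>) / (2 * pi)"
    by (intro divide_right_mono dist_ecirc_le) simp
  then show ?thesis
    by (simp add: dterm_diff[OF False] abs_mult flip: right_diff_distrib)
qed (simp add: dterm_def)

text \<open>At most 2n frequencies, with coefficients at most 2 and terms that are n-Lipschitz, give
  a Lipschitz constant of at most 4n^2. A grid of mesh 1/n^2 therefore misses at most 4.\<close>

lemma norm_dpoly_le_net:
  assumes y: "\<And>h. h \<in> shell M n \<Longrightarrow> \<bar>y h\<bar> \<le> 2" and "n > 0"
    and net: "\<And>k. k \<le> n\<^sup>2 \<Longrightarrow> cmod (dpoly y M n (real k / real (n\<^sup>2))) \<le> B"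
    and t: "t \<in> {0..1}"
  shows "cmod (dpoly y M n t) \<le> B + 4"
proof -
  define k where "k = nat \<lfloor>t * real (n\<^sup>2)\<rfloor>"
  define s where "s = real k / real (n\<^sup>2)"
  have n2: "real (n\<^sup>2) > 0" using \<open>n > 0\<close> by simp
  have k: "real k \<le> t * real (n\<^sup>2)" "t * real (n\<^sup>2) < real k + 1"
    using t by (auto simp: k_def)
  have "t * real (n\<^sup>2) \<le> 1 * real (n\<^sup>2)"
    using t by (intro mult_right_mono) auto
  then have "real k \<le> real (n\<^sup>2)" using k by linarith
  then have "k \<le> n\<^sup>2" by (simp only: of_nat_le_iff)
  have ts: "\<bar>t - s\<bar> \<le> 1 / real (n\<^sup>2)"
  proof -
    have "t - s = (t * real (n\<^sup>2) - real k) / real (n\<^sup>2)"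
      unfolding s_def using n2 by (simp add: diff_divide_distrib)
    also have "\<bar>\<dots>\<bar> \<le> 1 / real (n\<^sup>2)"
      unfolding abs_divide using k by (intro frac_le) (use n2 in auto)
    finally show ?thesis .
  qed
  have "cmod (dpoly y M n t - dpoly y M n s) = cmod (\<Sum>h\<in>shell M n. (dterm h t - dterm h s) * of_real (y h))"
    by (simp add: dpoly_def sum_subtractf left_diff_distrib)
  also have "\<dots> \<le> real (card (shell M n)) * (real n * \<bar>t - s\<bar> * 2)"
  proof (rule sum_norm_bound)
    fix h assume h: "h \<in> shell M n"
    have "cmod (dterm h t - dterm h s) \<le> \<bar>of_int h\<bar> * \<bar>t - s\<bar>" by (rule norm_dterm_diff_le)
    also have "\<dots> \<le> real n * \<bar>t - s\<bar>"
      using h by (intro mult_right_mono) (auto simp: shell_def)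
    finally show "cmod ((dterm h t - dterm h s) * of_real (y h)) \<le> real n * \<bar>t - s\<bar> * 2"
      unfolding norm_mult using y[OF h] by (intro mult_mono) auto
  qed
  also have "\<dots> \<le> real (2 * n) * (real n * \<bar>t - s\<bar> * 2)"
    using card_shell_le[of M n] by (intro mult_right_mono) auto
  also have "\<dots> = 4 * (real (n\<^sup>2) * \<bar>t - s\<bar>)"
    by (simp add: power2_eq_square)
  also have "\<dots> \<le> 4"
    using ts n2 by (simp add: field_simps)
  finally show ?thesis
    using net[OF \<open>k \<le> n\<^sup>2\<close>] norm_triangle_sub[of "dpoly y M n t" "dpoly y M n s"]
    by (simp add: s_def)
qed

lemma dpoly_eq_0: "n \<le> M \<Longrightarrow> dpoly y M n t = 0"
  by (auto simp: dpoly_def shell_def intro!: sum.neutral)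

text \<open>Passing from n to n + 1 adds the frequencies n + 1 and -(n + 1), on which
  \<open>dterm\<close> is n + 1 times \<open>kterm\<close>. Increments with n < M vanish because the
  shells are still empty.\<close>

lemma kpoly_eq_dpoly_sum:
  assumes "M \<le> N"
  shows "kpoly y N t = kpoly y M t + (\<Sum>n<N. (dpoly y M (Suc n) t - dpoly y M n t) / of_nat (Suc n))"
  using assms
proof (induction rule: dec_induct)
  case base
  then show ?case by (simp add: dpoly_eq_0)
next
  case (step n)
  let ?E = "{- int (Suc n), int (Suc n)}"
  have "{-int (Suc n)..int (Suc n)} - {0} = ({-int n..int n} - {0}) \<union> ?E" by auto
  then have 1: "kpoly y (Suc n) t = kpoly y n t + (\<Sum>h\<in>?E. kterm h t * of_real (y h))"
    by (simp only: kpoly_def, subst sum.union_disjoint) auto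
  have "shell M (Suc n) = shell M n \<union> ?E" using step by (auto simp: shell_def)
  then have "dpoly y M (Suc n) t = dpoly y M n t + (\<Sum>h\<in>?E. dterm h t * of_real (y h))"
    by (simp only: dpoly_def, subst sum.union_disjoint) (simp_all, auto simp: shell_def)
  also have "(\<Sum>h\<in>?E. dterm h t * of_real (y h)) = of_nat (Suc n) * (\<Sum>h\<in>?E. kterm h t * of_real (y h))"
    unfolding sum_distrib_left by (intro sum.cong refl) (auto simp: dterm_def)
  finally have "(dpoly y M (Suc n) t - dpoly y M n t) / of_nat (Suc n) = (\<Sum>h\<in>?E. kterm h t * of_real (y h))"
    by (simp del: of_nat_Suc)
  then show ?case using 1 step by simp
qed

lemma uniform_limit_kpoly:
  assumes y: "\<And>h. \<bar>h\<bar> > int M \<Longrightarrow> \<bar>y h\<bar> \<le> 2"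
    and net: "\<And>n k. n > M \<Longrightarrow> k \<le> n\<^sup>2 \<Longrightarrow> cmod (dpoly y M n (real k / real (n\<^sup>2))) \<le> 2 * real n powr (3/4)"
  obtains g where "uniform_limit {0..1} (kpoly y) g sequentially"
    "\<And>t. t \<in> {0..1} \<Longrightarrow> cmod (g t - kpoly y M t) \<le> 6 * (\<Sum>n. real (n + M) powr (-5/4))"
proof -
  have D: "cmod (dpoly y M n t) \<le> 6 * real n powr (3/4)" if t: "t \<in> {0..1}" for n t
  proof (cases "n \<le> M")
    case False
    then have n: "n > M" "n > 0" by auto
    have "cmod (dpoly y M n t) \<le> 2 * real n powr (3/4) + 4"
      by (rule norm_dpoly_le_net[OF _ n(2) net t]) (use n y in \<open>auto simp: shell_def\<close>)
    \<comment> \<open>The additive grid error 4 is absorbed into the power, whence the constant 6 =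
      2 + 4.\<close>
    moreover have "1 \<le> real n powr (3/4)"
      using n by (intro ge_one_powr_ge_zero) auto
    ultimately show ?thesis by linarith
  qed (simp add: dpoly_eq_0)
  obtain g where g: "uniform_limit {0..1} (\<lambda>N t. \<Sum>n<N. (dpoly y M (Suc n) t - dpoly y M n t) / of_nat (Suc n)) g sequentially"
    "\<And>t. t \<in> {0..1} \<Longrightarrow> cmod (g t) \<le> 6 * (\<Sum>n. real (n + M) powr (-5/4))"
    by (rule uniform_limit_abel_sum[of M "dpoly y M" "{0..1}" 6]) (auto simp: dpoly_eq_0 D)
  show ?thesis
  proof
    have "uniform_limit {0..1} (\<lambda>N t. kpoly y M t + (\<Sum>n<N. (dpoly y M (Suc n) t - dpoly y M n t) / of_nat (Suc n)))
       (\<lambda>t. kpoly y M t + g t) sequentially"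
      by (intro uniform_limit_add uniform_limit_const g)
    moreover have "\<forall>\<^sub>F N in sequentially. \<forall>t\<in>{0..1}. kpoly y M t +
        (\<Sum>n<N. (dpoly y M (Suc n) t - dpoly y M n t) / of_nat (Suc n)) = kpoly y N t"
      using eventually_ge_at_top[of M] by eventually_elim (simp add: kpoly_eq_dpoly_sum)
    ultimately show "uniform_limit {0..1} (kpoly y) (\<lambda>t. kpoly y M t + g t) sequentially"
      by (subst (asm) uniform_limit_cong) auto
  qed (use g in auto)
qed

section \<open>Measurability and the Sato-Tate law\<close>

lemma unit_interval_countable_dense:
  obtains T :: "real set" where "countable T" "T \<subseteq> {0..1}" "closure T = {0..1}"
proof -
  obtain T :: "real set" where T: "countable T" "T \<subseteq> {0..1}" "{0..1} \<subseteq> closure T"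
    by (rule separable)
  moreover have "closure T \<subseteq> {0..1}" using T by (intro closure_minimal) auto
  ultimately show ?thesis using that by blast
qed

text \<open>For countable T the right side uses only countably many quantifiers, hence is measurable
  in a parameter. Non-strict inequalities are used because they extend from T to its closure by
  continuity.\<close>

lemma uniformly_Cauchy_on_closure_iff:
  fixes f :: "nat \<Rightarrow> 'a::metric_space \<Rightarrow> complex"
  assumes "\<And>n. continuous_on (closure T) (f n)"
  shows "uniformly_Cauchy_on (closure T) f \<longleftrightarrow>
    (\<forall>j. \<exists>N. \<forall>m\<ge>N. \<forall>n\<ge>N. \<forall>t\<in>T. cmod (f m t - f n t) \<le> 1 / real (Suc j))"
    (is "?L \<longleftrightarrow> ?R")
proof
  assume ?L
  show ?R
  proof
    fix j
    have "0 < 1 / real (Suc j)" by simp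
    with \<open>?L\<close> obtain N where N: "\<And>t m n. t \<in> closure T \<Longrightarrow> m \<ge> N \<Longrightarrow> n \<ge> N \<Longrightarrow> dist (f m t) (f n t) < 1 / real (Suc j)"
      unfolding uniformly_Cauchy_on_def by meson
    show "\<exists>N. \<forall>m\<ge>N. \<forall>n\<ge>N. \<forall>t\<in>T. cmod (f m t - f n t) \<le> 1 / real (Suc j)"
      using less_imp_le[OF N] closure_subset[of T] unfolding dist_norm by blast
  qed
next
  assume ?R
  show ?L
    unfolding uniformly_Cauchy_on_def
  proof (intro allI impI)
    fix e :: real assume "e > 0"
    then obtain j where j: "1 / real (Suc j) < e"
      using nat_approx_posE by blast
    from \<open>?R\<close> obtain N where N: "\<And>m n t. m \<ge> N \<Longrightarrow> n \<ge> N \<Longrightarrow> t \<in> T \<Longrightarrow> cmod (f m t - f n t) \<le> 1 / real (Suc j)"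
      by blast
    have "dist (f m t) (f n t) < e" if "m \<ge> N" "n \<ge> N" "t \<in> closure T" for m n t
    proof -
      have "cmod (f m t - f n t) \<le> 1 / real (Suc j)"
        by (rule continuous_le_on_closure[OF _ that(3) N[OF that(1,2)]])
           (intro continuous_intros assms)
      then show ?thesis using j by (simp add: dist_norm)
    qed
    then show "\<exists>N. \<forall>t\<in>closure T. \<forall>m\<ge>N. \<forall>n\<ge>N. dist (f m t) (f n t) < e" by blast
  qed
qed

text \<open>A strict bound on the supremum is a non-strict bound with some margin 1/(j+1), and the
  latter can be tested on T.\<close>

lemma SUP_norm_less_closure_iff:
  fixes f :: "'a::metric_space \<Rightarrow> complex"
  assumes f: "continuous_on (closure T) f" and T: "compact (closure T)" "T \<noteq> {}"
  shows "(SUP t\<in>closure T. cmod (f t)) < \<epsilon> \<longleftrightarrow> (\<exists>j. \<forall>t\<in>T. cmod (f t) \<le> \<epsilon> - 1 / real (Suc j))"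
    (is "?S < \<epsilon> \<longleftrightarrow> _")
proof
  assume "?S < \<epsilon>"
  then obtain j where j: "1 / real (Suc j) < \<epsilon> - ?S"
    using nat_approx_posE[of "\<epsilon> - ?S"] by auto
  have "bdd_above ((\<lambda>t. cmod (f t)) ` closure T)"
    by (intro bounded_imp_bdd_above compact_imp_bounded compact_continuous_image continuous_intros f T)
  then have "cmod (f t) \<le> ?S" if "t \<in> T" for t
    using that closure_subset by (intro cSUP_upper) auto
  then show "\<exists>j. \<forall>t\<in>T. cmod (f t) \<le> \<epsilon> - 1 / real (Suc j)"
    using j by (intro exI[of _ j]) force
next
  assume "\<exists>j. \<forall>t\<in>T. cmod (f t) \<le> \<epsilon> - 1 / real (Suc j)"
  then obtain j where j: "\<And>t. t \<in> T \<Longrightarrow> cmod (f t) \<le> \<epsilon> - 1 / real (Suc j)" by blast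
  have "?S \<le> \<epsilon> - 1 / real (Suc j)"
    using T continuous_le_on_closure[OF continuous_on_norm[OF f] _ j] by (intro cSUP_least) auto
  also have "\<dots> < \<epsilon>" by simp
  finally show "?S < \<epsilon>" .
qed

lemma K_fun_uniform_limit:
  assumes "uniform_limit {0..1} (\<lambda>N. K_partial ST N \<omega>) g sequentially" "t \<in> {0..1}"
  shows "K_fun ST \<omega> t = g t"
proof -
  have "(\<lambda>N. K_partial ST N \<omega> t) \<longlonglongrightarrow> g t"
    using tendsto_uniform_limitI assms by fastforce
  then show ?thesis
    using assms by (auto simp: K_fun_def limI)
qed

lemma continuous_on_K_fun: "continuous_on {0..1} (K_fun ST \<omega>)"
proof (cases "\<exists>g. uniform_limit {0..1} (\<lambda>N. K_partial ST N \<omega>) g sequentially")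
  case True
  then obtain g where g: "uniform_limit {0..1} (\<lambda>N. K_partial ST N \<omega>) g sequentially" by blast
  have "continuous_on {0..1} g"
    by (rule uniform_limit_theorem[OF always_eventually g])
       (auto simp: K_partial_eq_kpoly intro: continuous_on_kpoly)
  then show ?thesis
    using K_fun_uniform_limit[OF g] continuous_on_cong by metis
next
  case False
  then have "K_fun ST \<omega> = (\<lambda>_. 0)" by (simp add: K_fun_def fun_eq_iff)
  then show ?thesis by simp
qed

lemma SUP_K_fun_less_sets:
  assumes [measurable]: "\<And>h. ST h \<in> borel_measurable M" and f: "continuous_on {0..1} f"
  shows "{\<omega> \<in> space M. (SUP t\<in>{0..1}. cmod (K_fun ST \<omega> t - f t)) < \<epsilon>} \<in> sets M"
proof -
  obtain T :: "real set" where T: "countable T" "T \<subseteq> {0..1}" "closure T = {0..1}"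
    by (rule unit_interval_countable_dense)
  have T_ne: "T \<noteq> {}" using T(3) by force
  have [measurable]: "(\<lambda>\<omega>. K_partial ST N \<omega> t) \<in> borel_measurable M" for N t
    unfolding K_partial_def by measurable
  \<comment> \<open>By completeness, existence of a uniform limit is the uniform Cauchy property,
    which removes the quantifier over functions g.\<close>
  have U: "(\<exists>g. uniform_limit {0..1} (\<lambda>N. K_partial ST N \<omega>) g sequentially) \<longleftrightarrow>
     (\<forall>j. \<exists>N. \<forall>m\<ge>N. \<forall>n\<ge>N. \<forall>t\<in>T. cmod (K_partial ST m \<omega> t - K_partial ST n \<omega> t) \<le> 1 / real (Suc j))" for \<omega>
    using uniformly_Cauchy_on_closure_iff[of T "\<lambda>N. K_partial ST N \<omega>"]
    by (simp add: T uniformly_convergent_on_def K_partial_eq_kpoly continuous_on_kpoly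
          flip: uniformly_convergent_eq_Cauchy del: of_nat_Suc)
  have [measurable]: "(\<lambda>\<omega>. K_fun ST \<omega> t) \<in> borel_measurable M" for t
  proof -
    have "Measurable.pred M (\<lambda>\<omega>. \<forall>j. \<exists>N. \<forall>m\<ge>N. \<forall>n\<ge>N. \<forall>t\<in>T.
        cmod (K_partial ST m \<omega> t - K_partial ST n \<omega> t) \<le> 1 / real (Suc j))"
      using T(1) by measurable
    then have [measurable]: "Measurable.pred M (\<lambda>\<omega>. \<exists>g. uniform_limit {0..1} (\<lambda>N. K_partial ST N \<omega>) g sequentially)"
      unfolding U .
    show ?thesis unfolding K_fun_def by measurable
  qed
  have "{\<omega> \<in> space M. (SUP t\<in>{0..1}. cmod (K_fun ST \<omega> t - f t)) < \<epsilon>} =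
     {\<omega> \<in> space M. \<exists>j. \<forall>t\<in>T. cmod (K_fun ST \<omega> t - f t) \<le> \<epsilon> - 1 / real (Suc j)}"
  proof -
    have "(SUP t\<in>{0..1}. cmod (K_fun ST \<omega> t - f t)) < \<epsilon> \<longleftrightarrow>
        (\<exists>j. \<forall>t\<in>T. cmod (K_fun ST \<omega> t - f t) \<le> \<epsilon> - 1 / real (Suc j))" for \<omega>
      using SUP_norm_less_closure_iff[of T "\<lambda>t. K_fun ST \<omega> t - f t" \<epsilon>] T_ne
      unfolding T(3) by (blast intro: continuous_on_diff continuous_on_K_fun f compact_Icc)
    then show ?thesis by simp
  qed
  also have "\<dots> \<in> sets M"
    using T(1) by measurable
  finally show ?thesis .
qed

section \<open>The Sato-Tate law: symmetry and full support on [-2,2]\<close>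

lemma sato_tate_density_measurable [measurable]: "sato_tate_density \<in> borel_measurable borel"
  unfolding sato_tate_density_def by measurable

lemma sato_tate_mean: "integral\<^sup>L (density lborel sato_tate_density) (\<lambda>x. x) = 0"
proof -
  define d where "d x = (if x \<in> {-2..2} then sqrt (1 - x\<^sup>2 / 4) / pi else 0)" for x :: real
  have [measurable]: "d \<in> borel_measurable borel" unfolding d_def by measurable
  have d0: "0 \<le> d x" for x
  proof -
    have "x\<^sup>2 \<le> 2\<^sup>2" if "x \<in> {-2..2}"
      using that by (intro abs_le_square_iff[THEN iffD1]) auto
    then show ?thesis by (auto simp: d_def)
  qed
  have sd: "sato_tate_density = (\<lambda>x. ennreal (d x))"
    by (auto simp: sato_tate_density_def d_def)
  have "integral\<^sup>L (density lborel sato_tate_density) (\<lambda>x. x) = (\<integral>x. d x *\<^sub>R x \<partial>lborel)"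
    unfolding sd by (subst integral_density) (auto simp: d0)
  \<comment> \<open>The substitution x to -x and the evenness of d show that the mean equals its own
    negative.\<close>
  also have "\<dots> = (\<integral>x. d (0 + (-1) * x) *\<^sub>R (0 + (-1) * x) \<partial>lborel)"
    by (subst lborel_integral_real_affine[of "-1" _ 0]) auto
  also have "\<dots> = - (\<integral>x. d x *\<^sub>R x \<partial>lborel)"
  proof -
    have "d (- x) = d x" for x by (auto simp: d_def)
    then show ?thesis by simp
  qed
  finally show ?thesis
    using \<open>integral\<^sup>L (density lborel sato_tate_density) (\<lambda>x. x) = (\<integral>x. d x *\<^sub>R x \<partial>lborel)\<close> by simp
qed

lemma sato_tate_interval_pos:
  assumes "\<bar>y\<bar> \<le> 2" "\<delta> > 0"
  shows "emeasure (density lborel sato_tate_density) {x. \<bar>x - y\<bar> < \<delta>} > 0"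
proof (rule ccontr)
  assume "\<not> ?thesis"
  have S [measurable]: "{x. \<bar>x - y\<bar> < \<delta>} \<in> sets borel" by measurable
  with \<open>\<not> ?thesis\<close> have "(\<integral>\<^sup>+x. sato_tate_density x * indicator {x. \<bar>x - y\<bar> < \<delta>} x \<partial>lborel) = 0"
    by (simp add: emeasure_density)
  then have AE: "AE x in lborel. sato_tate_density x * indicator {x. \<bar>x - y\<bar> < \<delta>} x = 0"
    by (subst (asm) nn_integral_0_iff_AE) auto
  \<comment> \<open>The open interval (a, b) is the part of the \<delta>-ball inside (-2,2). It is
    nonempty even for y = 2 or y = -2, and the density is positive on it.\<close>
  define a b where "a = max (-2) (y - \<delta>)" and "b = min 2 (y + \<delta>)"
  have "a < b" using assms by (auto simp: a_def b_def)
  have "sato_tate_density x * indicator {x. \<bar>x - y\<bar> < \<delta>} x \<noteq> 0" if "x \<in> {a<..<b}" for x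
  proof -
    have x: "\<bar>x\<bar> < 2" "\<bar>x - y\<bar> < \<delta>" using that by (auto simp: a_def b_def)
    have "x\<^sup>2 < 2\<^sup>2" using x(1) power_strict_mono[of "\<bar>x\<bar>" 2 2] by simp
    then have "sqrt (1 - x\<^sup>2 / 4) / pi > 0" by simp
    then show ?thesis using x by (auto simp: sato_tate_density_def)
  qed
  then have "AE x in lborel. x \<notin> {a<..<b}"
    using AE by (auto elim!: eventually_mono)
  then have "emeasure lborel {a<..<b} = 0"
    by (subst (asm) AE_iff_measurable[of "{a<..<b}"]) auto
  then show False using \<open>a < b\<close> by simp
qed

section \<open>Independent Sato-Tate variables\<close>

locale sato_tate_family = prob_space M for M :: "'a measure" +
  fixes ST :: "int \<Rightarrow> 'a \<Rightarrow> real"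
  assumes indep: "indep_vars (\<lambda>_. borel) ST UNIV"
    and law: "\<And>h. distr M borel (ST h) = density lborel sato_tate_density"
begin

lemma measurable_ST [measurable]: "ST h \<in> borel_measurable M"
  using indep by (simp add: indep_vars_def)

lemma AE_abs_ST_le: "AE \<omega> in M. \<bar>ST h \<omega>\<bar> \<le> 2"
proof -
  have "AE x in density lborel sato_tate_density. \<bar>x\<bar> \<le> 2"
    by (subst AE_density) (auto simp: sato_tate_density_def)
  then show ?thesis
    unfolding law[of h, symmetric] by (subst (asm) AE_distr_iff) auto
qed

lemma AE_all_abs_ST_le: "AE \<omega> in M. \<forall>h. \<bar>ST h \<omega>\<bar> \<le> 2"
  using AE_abs_ST_le by (simp add: AE_all_countable)

lemma expectation_ST: "expectation (ST h) = 0"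
proof -
  have "expectation (ST h) = integral\<^sup>L (distr M borel (ST h)) (\<lambda>x. x)"
    by (subst integral_distr) auto
  then show ?thesis by (simp add: law sato_tate_mean)
qed

lemma prob_ST_near_pos:
  assumes "\<bar>y\<bar> \<le> 2" "\<delta> > 0"
  shows "prob (ST h -` {x. \<bar>x - y\<bar> < \<delta>} \<inter> space M) > 0"
proof -
  have S: "{x. \<bar>x - y\<bar> < \<delta>} \<in> sets borel" by measurable
  have "emeasure M (ST h -` {x. \<bar>x - y\<bar> < \<delta>} \<inter> space M) > 0"
    using sato_tate_interval_pos[OF assms] S unfolding law[of h, symmetric]
    by (subst (asm) emeasure_distr) auto
  then show ?thesis by (simp add: emeasure_eq_measure)
qed

text \<open>Hoeffding for centred variables in [-2,2]: each range has squared length 16, so the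
  exponent is 2\<epsilon>^2/(16 card I), and card I \<le> 2n reduces it to
  \<epsilon>^2/(16n).\<close>

lemma prob_weighted_sum_ge:
  assumes I: "finite I" "I \<noteq> {}" "card I \<le> 2 * n" and c: "\<And>h. h \<in> I \<Longrightarrow> \<bar>c h\<bar> \<le> 1" and "\<epsilon> \<ge> 0"
  shows "prob {\<omega> \<in> space M. \<bar>\<Sum>h\<in>I. c h * ST h \<omega>\<bar> \<ge> \<epsilon>} \<le> 2 * exp (- (\<epsilon>\<^sup>2 / (16 * real n)))"
proof -
  interpret Hoeffding_ineq M I "\<lambda>h \<omega>. c h * ST h \<omega>" "\<lambda>_. -2" "\<lambda>_. 2" "\<Sum>h\<in>I. expectation (\<lambda>\<omega>. c h * ST h \<omega>)"
  proof unfold_locales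
    show "indep_vars (\<lambda>_. borel) (\<lambda>h \<omega>. c h * ST h \<omega>) I"
      by (rule indep_vars_compose2[OF indep_vars_subset[OF indep]]) auto
    fix h assume "h \<in> I"
    show "AE \<omega> in M. c h * ST h \<omega> \<in> {-2..2}"
      using AE_abs_ST_le[of h]
    proof eventually_elim
      case (elim \<omega>)
      have "\<bar>c h * ST h \<omega>\<bar> \<le> 1 * 2"
        unfolding abs_mult using c[OF \<open>h \<in> I\<close>] elim by (intro mult_mono) auto
      then show ?case by auto
    qed
  qed (use I in simp_all)
  have I0: "0 < card I" using I by (simp add: card_gt_0_iff)
  have "prob {\<omega> \<in> space M. \<bar>\<Sum>h\<in>I. c h * ST h \<omega>\<bar> \<ge> \<epsilon>} \<le> 2 * exp (-2 * \<epsilon>\<^sup>2 / (16 * real (card I)))"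
    using Hoeffding_ineq_abs_ge[OF \<open>\<epsilon> \<ge> 0\<close>] I0 by (simp add: expectation_ST)
  also have "\<dots> \<le> 2 * exp (- (\<epsilon>\<^sup>2 / (16 * real n)))"
  proof -
    have "\<epsilon>\<^sup>2 / (16 * real n) = 2 * \<epsilon>\<^sup>2 / (16 * real (2 * n))" by simp
    also have "\<dots> \<le> 2 * \<epsilon>\<^sup>2 / (16 * real (card I))"
      using I(3) I0 by (intro divide_left_mono mult_pos_pos mult_left_mono) auto
    finally show ?thesis by simp
  qed
  finally show ?thesis .
qed

section \<open>The tail event and its independence from the head\<close>

lemma measurable_dpoly_ST [measurable]:
  "(\<lambda>\<omega>. dpoly (\<lambda>h. ST h \<omega>) m n t) \<in> borel_measurable M"
  unfolding dpoly_def by measurable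

text \<open>Real and imaginary parts are real weighted sums with weights at most 1. If the modulus
  exceeds 2 n^(3/4), one of them exceeds n^(3/4), and Hoeffding applies to each.\<close>

lemma prob_dpoly_large:
  assumes "m < n"
  shows "prob {\<omega> \<in> space M. cmod (dpoly (\<lambda>h. ST h \<omega>) m n t) > 2 * real n powr (3/4)}
    \<le> 4 * exp (- sqrt (real n) / 16)"
proof -
  have n: "real n > 0" using assms by auto
  have shell: "shell m n \<noteq> {}"
    using assms by (auto simp: shell_def intro!: exI[of _ "int n"])
  have e: "(real n powr (3/4))\<^sup>2 / (16 * real n) = sqrt (real n) / 16"
  proof -
    have "(real n powr (3/4))\<^sup>2 = real n powr (1 + 1/2)"
      by (simp add: power2_eq_square flip: powr_add)
    also have "\<dots> = real n * sqrt (real n)"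
      using n powr_half_sqrt[of "real n"] by (subst powr_add) simp
    finally show ?thesis using n by simp
  qed
  have part: "prob {\<omega> \<in> space M. \<bar>\<Sum>h\<in>shell m n. c h * ST h \<omega>\<bar> \<ge> real n powr (3/4)} \<le> 2 * exp (- sqrt (real n) / 16)"
    if "\<And>h. \<bar>c h\<bar> \<le> 1" for c
    using prob_weighted_sum_ge[OF finite_shell shell card_shell_le, of c "real n powr (3/4)"] that
    by (simp add: e)
  let ?A = "\<lambda>p. {\<omega> \<in> space M. \<bar>\<Sum>h\<in>shell m n. p (dterm h t) * ST h \<omega>\<bar> \<ge> real n powr (3/4)}"
  have "prob {\<omega> \<in> space M. cmod (dpoly (\<lambda>h. ST h \<omega>) m n t) > 2 * real n powr (3/4)}
    \<le> prob (?A Re \<union> ?A Im)"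
  proof (rule finite_measure_mono)
    have "Re (dpoly (\<lambda>h. ST h \<omega>) m n t) = (\<Sum>h\<in>shell m n. Re (dterm h t) * ST h \<omega>)"
      "Im (dpoly (\<lambda>h. ST h \<omega>) m n t) = (\<Sum>h\<in>shell m n. Im (dterm h t) * ST h \<omega>)" for \<omega>
      by (simp_all add: dpoly_def)
    then have "cmod (dpoly (\<lambda>h. ST h \<omega>) m n t) \<le>
        \<bar>\<Sum>h\<in>shell m n. Re (dterm h t) * ST h \<omega>\<bar> + \<bar>\<Sum>h\<in>shell m n. Im (dterm h t) * ST h \<omega>\<bar>" for \<omega>
      using cmod_le[of "dpoly (\<lambda>h. ST h \<omega>) m n t"] by simp
    then show "{\<omega> \<in> space M. cmod (dpoly (\<lambda>h. ST h \<omega>) m n t) > 2 * real n powr (3/4)} \<subseteq> ?A Re \<union> ?A Im"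
      by (smt (verit) Un_iff mem_Collect_eq subsetI)
  qed measurable
  also have "\<dots> \<le> prob (?A Re) + prob (?A Im)"
    by (rule measure_Un_le) measurable
  also have "\<dots> \<le> 2 * exp (- sqrt (real n) / 16) + 2 * exp (- sqrt (real n) / 16)"
    by (intro add_mono part) (use abs_Re_le_cmod abs_Im_le_cmod norm_dterm_le order_trans in blast)+
  finally show ?thesis by simp
qed

text \<open>The grid of mesh \<open>1/n\<^sup>2\<close> controls a polynomial of degree \<open>n\<close> up to a bounded error,
  and the threshold \<open>n\<^sup>3\<^sup>/\<^sup>4\<close> is above the typical size \<open>n\<^sup>1\<^sup>/\<^sup>2\<close> by enough to absorb the number of grid points.\<close>
definition tail_good :: "nat \<Rightarrow> (int \<Rightarrow> real) \<Rightarrow> bool" where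
  "tail_good m y \<longleftrightarrow> (\<forall>h. \<bar>h\<bar> > int m \<longrightarrow> \<bar>y h\<bar> \<le> 2) \<and>
     (\<forall>n>m. \<forall>k\<le>n\<^sup>2. cmod (dpoly y m n (real k / real (n\<^sup>2))) \<le> 2 * real n powr (3/4))"

text \<open>Union bound for degree n: the number of grid points times the bound at one
  point.\<close>

definition tail_weight :: "nat \<Rightarrow> real" where
  "tail_weight n = (real (n\<^sup>2) + 1) * (4 * exp (- sqrt (real n) / 16))"

lemma summable_tail_weight: "summable tail_weight"
proof (rule summable_comparison_test_bigo)
  show "summable (\<lambda>n. norm (real n powr (-2)))"
    by (simp add: summable_real_powr_iff)
  show "tail_weight \<in> O(\<lambda>n. real n powr (-2))"
    unfolding tail_weight_def by real_asymp
qed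

lemma prob_tail_good_pos:
  assumes m: "(\<Sum>n. tail_weight (n + Suc m)) < 1"
  shows "prob {\<omega> \<in> space M. tail_good m (\<lambda>h. ST h \<omega>)} > 0"
proof -
  define A where "A n k = {\<omega> \<in> space M. cmod (dpoly (\<lambda>h. ST h \<omega>) m n (real k / real (n\<^sup>2))) > 2 * real n powr (3/4)}" for n k
  \<comment> \<open>The shift by \<open>Suc m\<close> makes the sets B run over exactly the degrees
    above m.\<close>
  define B where "B n = (\<Union>k\<in>{..(n + Suc m)\<^sup>2}. A (n + Suc m) k)" for n
  have [measurable]: "A n k \<in> events" for n k unfolding A_def by measurable
  have [measurable]: "B n \<in> events" for n unfolding B_def by measurable
  have B_le: "prob (B n) \<le> tail_weight (n + Suc m)" for n
  proof -
    have "prob (B n) \<le> (\<Sum>k\<in>{..(n + Suc m)\<^sup>2}. prob (A (n + Suc m) k))"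
      unfolding B_def by (rule measure_UNION_le) auto
    also have "\<dots> \<le> (\<Sum>k\<in>{..(n + Suc m)\<^sup>2}. 4 * exp (- sqrt (real (n + Suc m)) / 16))"
      unfolding A_def by (intro sum_mono prob_dpoly_large) auto
    also have "\<dots> = tail_weight (n + Suc m)"
      by (simp add: tail_weight_def)
    finally show ?thesis .
  qed
  have s: "summable (\<lambda>n. tail_weight (n + Suc m))"
    using summable_tail_weight by (rule summable_ignore_initial_segment)
  have sB: "summable (\<lambda>n. prob (B n))"
    by (rule summable_comparison_test[OF _ s]) (use B_le in auto)
  have "prob (\<Union>n. B n) \<le> (\<Sum>n. prob (B n))"
    by (rule finite_measure_subadditive_countably) (use sB in auto)
  also have "\<dots> \<le> (\<Sum>n. tail_weight (n + Suc m))"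
    by (rule suminf_le[OF B_le sB s])
  finally have lt: "prob (\<Union>n. B n) < 1" using m by simp
  \<comment> \<open>Equality holds only up to a null set: \<open>tail_good\<close> also demands
    values in [-2,2], which is almost sure.\<close>
  have "prob {\<omega> \<in> space M. tail_good m (\<lambda>h. ST h \<omega>)} = prob (space M - (\<Union>n. B n))"
  proof (rule finite_measure_eq_AE)
    show "AE \<omega> in M. \<omega> \<in> {\<omega> \<in> space M. tail_good m (\<lambda>h. ST h \<omega>)} \<longleftrightarrow> \<omega> \<in> space M - (\<Union>n. B n)"
      using AE_all_abs_ST_le
    proof eventually_elim
      case (elim \<omega>)
      have "(\<omega> \<in> (\<Union>n. B n)) \<longleftrightarrow> (\<exists>n>m. \<exists>k\<le>n\<^sup>2. \<omega> \<in> A n k)"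
      proof
        assume "\<exists>n>m. \<exists>k\<le>n\<^sup>2. \<omega> \<in> A n k"
        then obtain n k where "m < n" "k \<le> n\<^sup>2" "\<omega> \<in> A n k" by blast
        moreover obtain i where "n = i + Suc m" using \<open>m < n\<close> by (metis Suc_leI le_add_diff_inverse2)
        ultimately show "\<omega> \<in> (\<Union>n. B n)" unfolding B_def by blast
      next
        assume "\<omega> \<in> (\<Union>n. B n)"
        then obtain i k where "k \<le> (i + Suc m)\<^sup>2" "\<omega> \<in> A (i + Suc m) k" unfolding B_def by blast
        then show "\<exists>n>m. \<exists>k\<le>n\<^sup>2. \<omega> \<in> A n k" by (intro exI[of _ "i + Suc m"]) auto
      qed
      then show ?case using elim unfolding A_def tail_good_def mem_Collect_eq Diff_iff
        by (simp only: linorder_not_less[symmetric]) blast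
    qed
    show "{\<omega> \<in> space M. tail_good m (\<lambda>h. ST h \<omega>)} \<in> events"
      unfolding tail_good_def by measurable
  qed measurable
  also have "\<dots> = 1 - prob (\<Union>n. B n)" by (rule prob_compl) measurable
  finally show ?thesis using lt by simp
qed

lemma prob_head_tail_pos:
  assumes m: "(\<Sum>n. tail_weight (n + Suc m)) < 1" and y: "\<And>h. \<bar>y h\<bar> \<le> 2" and "\<delta> > 0"
  shows "prob {\<omega> \<in> space M. (\<forall>h\<in>{-int m..int m}. \<bar>ST h \<omega> - y h\<bar> < \<delta>) \<and> tail_good m (\<lambda>h. ST h \<omega>)} > 0"
proof -
  let ?A = "{-int m..int m}" and ?B = "{h. \<bar>h\<bar> > int m}"
  let ?P = "\<lambda>I. PiM I (\<lambda>_. borel :: real measure)"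
  let ?R = "\<lambda>I \<omega>. restrict (\<lambda>h. ST h \<omega>) I"
  \<comment> \<open>Independence of the two blocks of variables is stated for random elements of
    product spaces, so head and tail events are written as preimages of measurable sets
    there.\<close>
  define U where "U = {z \<in> space (?P ?A). \<forall>h\<in>?A. \<bar>z h - y h\<bar> < \<delta>}"
  define V where "V = {z \<in> space (?P ?B). tail_good m z}"
  have U: "U \<in> sets (?P ?A)" unfolding U_def by measurable
  have V: "V \<in> sets (?P ?B)"
  proof -
    have [measurable]: "(\<lambda>z. z h) \<in> borel_measurable (?P ?B)" if "\<bar>h\<bar> > int m" for h
      using that by (intro measurable_component_singleton) auto
    have [measurable]: "(\<lambda>z. dpoly z m n t) \<in> borel_measurable (?P ?B)" for n t
      unfolding dpoly_def
      by (intro borel_measurable_sum borel_measurable_times borel_measurable_const borel_measurable_of_real) (auto simp: shell_def)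
    have "V = {z \<in> space (?P ?B). (\<forall>h\<in>?B. \<bar>z h\<bar> \<le> 2) \<and>
     (\<forall>n. n > m \<longrightarrow> (\<forall>k. k \<le> n\<^sup>2 \<longrightarrow> cmod (dpoly z m n (real k / real (n\<^sup>2))) \<le> 2 * real n powr (3/4)))}"
      by (auto simp: V_def tail_good_def)
    also have "\<dots> \<in> sets (?P ?B)" by measurable
    finally show ?thesis .
  qed
  \<comment> \<open>\<open>tail_good m\<close> reads only coordinates with |h| > m, so the undefined
    values of the restriction are never seen.\<close>
  have restr: "tail_good m (?R ?B \<omega>) \<longleftrightarrow> tail_good m (\<lambda>h. ST h \<omega>)" for \<omega>
  proof -
    have "dpoly (?R ?B \<omega>) m n t = dpoly (\<lambda>h. ST h \<omega>) m n t" for n t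
      unfolding dpoly_def by (intro sum.cong) (auto simp: shell_def)
    then show ?thesis by (simp add: tail_good_def)
  qed
  have ind: "indep_var (?P ?A) (?R ?A) (?P ?B) (?R ?B)"
    by (rule indep_var_restrict[OF indep]) auto
  have "prob (\<Inter>h\<in>?A. ST h -` {x. \<bar>x - y h\<bar> < \<delta>} \<inter> space M) = (\<Prod>h\<in>?A. prob (ST h -` {x. \<bar>x - y h\<bar> < \<delta>} \<inter> space M))"
    by (rule indep_varsD_finite[OF indep_vars_subset[OF indep]]) auto
  also have "\<dots> > 0"
    by (intro prod_pos prob_ST_near_pos y \<open>\<delta> > 0\<close> ballI)
  also have "(\<Inter>h\<in>?A. ST h -` {x. \<bar>x - y h\<bar> < \<delta>} \<inter> space M) = ?R ?A -` U \<inter> space M"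
    by (auto simp: U_def space_PiM)
  finally have 1: "prob (?R ?A -` U \<inter> space M) > 0" .
  have "?R ?B -` V \<inter> space M = {\<omega> \<in> space M. tail_good m (\<lambda>h. ST h \<omega>)}"
    by (auto simp: V_def restr space_PiM)
  with prob_tail_good_pos[OF m] have 2: "prob (?R ?B -` V \<inter> space M) > 0" by simp
  have "prob ((\<lambda>\<omega>. (?R ?A \<omega>, ?R ?B \<omega>)) -` (U \<times> V) \<inter> space M) > 0"
    unfolding indep_varD[OF ind U V] using 1 2 by simp
  also have "(\<lambda>\<omega>. (?R ?A \<omega>, ?R ?B \<omega>)) -` (U \<times> V) \<inter> space M =
     {\<omega> \<in> space M. (\<forall>h\<in>?A. \<bar>ST h \<omega> - y h\<bar> < \<delta>) \<and> tail_good m (\<lambda>h. ST h \<omega>)}"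
    by (auto simp: U_def V_def restr space_PiM)
  finally show ?thesis .
qed

end

section \<open>The support\<close>

lemma norm_kpoly_diff_le:
  assumes "\<And>h. h \<in> {-int m..int m} \<Longrightarrow> \<bar>z h - y h\<bar> \<le> \<delta>" and t: "t \<in> {0..1}"
  shows "cmod (kpoly z m t - kpoly y m t) \<le> (2 * real m + 1) * \<delta>"
proof -
  have "\<delta> \<ge> 0" using assms(1)[of 0] by simp
  have "kpoly z m t - kpoly y m t = of_real t * of_real (z 0 - y 0) +
      (\<Sum>h\<in>{-int m..int m} - {0}. kterm h t * of_real (z h - y h))"
    by (simp add: kpoly_def right_diff_distrib sum_subtractf)
  also have "cmod \<dots> \<le> cmod (of_real t * of_real (z 0 - y 0)) +
      cmod (\<Sum>h\<in>{-int m..int m} - {0}. kterm h t * of_real (z h - y h))"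
    by (rule norm_triangle_ineq)
  also have "cmod (of_real t * of_real (z 0 - y 0)) \<le> 1 * \<delta>"
    unfolding norm_mult norm_of_real using t assms(1)[of 0] by (intro mult_mono) auto
  also have "cmod (\<Sum>h\<in>{-int m..int m} - {0}. kterm h t * of_real (z h - y h)) \<le>
      real (card ({-int m..int m} - {0})) * (1 * \<delta>)"
    by (rule sum_norm_bound, unfold norm_mult norm_of_real, intro mult_mono norm_kterm_le)
       (use assms(1) in auto)
  also have "real (card ({-int m..int m} - {0})) = 2 * real m"
    by (simp add: card_Diff_singleton)
  finally show ?thesis by (simp add: algebra_simps)
qed

text \<open>Padding with zeros, which are admissible coefficients, lets the degree be raised until
  the tail is small.\<close>

lemma kpoly_truncate:
  assumes "N \<le> m"
  shows "kpoly (\<lambda>h. if \<bar>h\<bar> \<le> int N then y h else 0) m t = kpoly y N t"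
proof -
  have "(\<Sum>h\<in>{-int m..int m} - {0}. kterm h t * of_real (if \<bar>h\<bar> \<le> int N then y h else 0)) =
      (\<Sum>h\<in>{-int N..int N} - {0}. kterm h t * of_real (y h))"
    using assms by (intro sum.mono_neutral_cong_right) auto
  then show ?thesis by (simp add: kpoly_def)
qed

context sato_tate_family
begin

lemma K_support_imp_kpoly_closure:
  assumes "f \<in> K_support M ST" "\<epsilon> > 0"
  shows "\<exists>y N. (\<forall>h. \<bar>y h\<bar> \<le> 2) \<and> (\<forall>t\<in>{0..1}. cmod (kpoly y N t - f t) < \<epsilon>)"
proof -
  define S where "S = {\<omega> \<in> space M. (SUP t\<in>{0..1}. cmod (K_fun ST \<omega> t - f t)) < \<epsilon> / 2}"
  have "\<epsilon> / 2 > 0" using assms by simp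
  then have f: "continuous_on {0..1} f" and "prob S > 0"
    using assms(1) unfolding K_support_def S_def by blast+
  have "S \<in> events" unfolding S_def by (rule SUP_K_fun_less_sets[OF measurable_ST f])
  \<comment> \<open>An event of positive probability meets the almost sure event that all variables
    lie in [-2,2].\<close>
  obtain \<omega> where \<omega>: "\<omega> \<in> S" "\<forall>h. \<bar>ST h \<omega>\<bar> \<le> 2"
  proof (rule ccontr)
    assume "\<not> thesis"
    then have "AE \<omega> in M. \<omega> \<notin> S" using that AE_all_abs_ST_le by (auto elim!: eventually_mono)
    then show False using \<open>prob S > 0\<close> prob_eq_0[OF \<open>S \<in> events\<close>] by simp
  qed
  have close: "cmod (K_fun ST \<omega> t - f t) < \<epsilon> / 2" if "t \<in> {0..1}" for t
  proof -
    have "bdd_above ((\<lambda>t. cmod (K_fun ST \<omega> t - f t)) ` {0..1})"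
      by (intro bounded_imp_bdd_above compact_imp_bounded compact_continuous_image
            continuous_intros f continuous_on_K_fun compact_Icc)
    then have "cmod (K_fun ST \<omega> t - f t) \<le> (SUP t\<in>{0..1}. cmod (K_fun ST \<omega> t - f t))"
      using that by (rule cSUP_upper[rotated])
    also have "\<dots> < \<epsilon> / 2" using \<omega> by (simp add: S_def)
    finally show ?thesis .
  qed
  show ?thesis
  proof (cases "\<exists>g. uniform_limit {0..1} (\<lambda>N. K_partial ST N \<omega>) g sequentially")
    case True
    then obtain g where g: "uniform_limit {0..1} (\<lambda>N. K_partial ST N \<omega>) g sequentially" by blast
    have "\<forall>\<^sub>F N in sequentially. \<forall>t\<in>{0..1}. dist (K_partial ST N \<omega> t) (g t) < \<epsilon> / 2"
      using g \<open>\<epsilon> > 0\<close> by (intro uniform_limitD) auto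
    then obtain N where N: "\<And>t. t \<in> {0..1} \<Longrightarrow> dist (K_partial ST N \<omega> t) (g t) < \<epsilon> / 2"
      unfolding eventually_sequentially by blast
    have "cmod (kpoly (\<lambda>h. ST h \<omega>) N t - f t) < \<epsilon>" if t: "t \<in> {0..1}" for t
    proof -
      have "dist (kpoly (\<lambda>h. ST h \<omega>) N t) (f t) < \<epsilon>"
        using N[OF t] close[OF t] dist_triangle[of "kpoly (\<lambda>h. ST h \<omega>) N t" "f t" "g t"]
        unfolding K_fun_uniform_limit[OF g t] K_partial_eq_kpoly dist_norm[symmetric] by simp
      then show ?thesis by (simp add: dist_norm)
    qed
    with \<omega>(2) show ?thesis
      by (intro exI[of _ "\<lambda>h. ST h \<omega>"] exI[of _ N] conjI ballI)
  next
    case False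
    \<comment> \<open>Here \<open>K_fun\<close> takes its default value 0, which is itself a polynomial of the family.\<close>
    then have "K_fun ST \<omega> t = kpoly (\<lambda>_. 0) 0 t" for t by (simp add: K_fun_def kpoly_def)
    then have "cmod (kpoly (\<lambda>_. 0) 0 t - f t) < \<epsilon>" if "t \<in> {0..1}" for t
      using close[OF that] \<open>\<epsilon> > 0\<close> by simp
    then show ?thesis by (intro exI[of _ "\<lambda>_. 0"] exI[of _ 0]) simp
  qed
qed

lemma kpoly_closure_imp_K_support:
  assumes f: "continuous_on {0..1} f"
    and approx: "\<And>\<epsilon>. \<epsilon> > 0 \<Longrightarrow> \<exists>y N. (\<forall>h. \<bar>y h\<bar> \<le> 2) \<and> (\<forall>t\<in>{0..1}. cmod (kpoly y N t - f t) < \<epsilon>)"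
  shows "f \<in> K_support M ST"
  unfolding K_support_def
proof (intro CollectI conjI f allI impI)
  fix \<epsilon> :: real assume "\<epsilon> > 0"
  then have "\<epsilon> / 4 > 0" by simp
  from approx[OF this] obtain y0 N where
    y0: "\<And>h. \<bar>y0 h\<bar> \<le> 2" "\<And>t. t \<in> {0..1} \<Longrightarrow> cmod (kpoly y0 N t - f t) < \<epsilon> / 4"
    by blast
  define y where "y h = (if \<bar>h\<bar> \<le> int N then y0 h else 0)" for h
  have y: "\<bar>y h\<bar> \<le> 2" for h using y0(1) by (simp add: y_def)
  \<comment> \<open>The tail of the series is at most 6 times this sum, hence at most
    \<epsilon>/4.\<close>
  obtain N1 where N1: "\<And>n. n \<ge> N1 \<Longrightarrow> norm (\<Sum>i. real (i + n) powr (-5/4)) < \<epsilon> / 24"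
    using suminf_exist_split[of "\<epsilon> / 24" "\<lambda>n. real n powr (-5/4)"] \<open>\<epsilon> > 0\<close>
    by (auto simp: summable_real_powr_iff)
  \<comment> \<open>From here on the bad grid events have total probability below 1, so the good
    tail event has positive probability.\<close>
  obtain N2 where N2: "\<And>n. n \<ge> N2 \<Longrightarrow> norm (\<Sum>i. tail_weight (i + n)) < 1"
    using suminf_exist_split[OF zero_less_one summable_tail_weight] by blast
  define m where "m = max N (max N1 N2)"
  \<comment> \<open>Chosen so that perturbing all 2m + 1 coefficients by \<delta> moves the
    polynomial by at most \<epsilon>/4.\<close>
  define \<delta> where "\<delta> = \<epsilon> / (4 * (2 * real m + 1))"
  have "\<delta> > 0" using \<open>\<epsilon> > 0\<close> by (simp add: \<delta>_def)
  have m: "(\<Sum>n. real (n + m) powr (-5/4)) < \<epsilon> / 24" "(\<Sum>n. tail_weight (n + Suc m)) < 1"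
  proof -
    have "N1 \<le> m" "N2 \<le> Suc m" by (auto simp: m_def)
    from N1[OF this(1)] N2[OF this(2)] show "(\<Sum>n. real (n + m) powr (-5/4)) < \<epsilon> / 24"
      "(\<Sum>n. tail_weight (n + Suc m)) < 1"
      unfolding real_norm_def by (linarith+)
  qed
  let ?G = "{\<omega> \<in> space M. (\<forall>h\<in>{-int m..int m}. \<bar>ST h \<omega> - y h\<bar> < \<delta>) \<and> tail_good m (\<lambda>h. ST h \<omega>)}"
  have "0 < prob ?G"
    by (rule prob_head_tail_pos[OF m(2) y \<open>\<delta> > 0\<close>])
  also have "\<dots> \<le> prob {\<omega> \<in> space M. (SUP t\<in>{0..1}. cmod (K_fun ST \<omega> t - f t)) < \<epsilon>}"
  proof (rule finite_measure_mono)
    show "?G \<subseteq> {\<omega> \<in> space M. (SUP t\<in>{0..1}. cmod (K_fun ST \<omega> t - f t)) < \<epsilon>}"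
    proof (intro subsetI CollectI conjI)
      fix \<omega> assume \<omega>: "\<omega> \<in> ?G"
      then have head: "\<And>h. h \<in> {-int m..int m} \<Longrightarrow> \<bar>ST h \<omega> - y h\<bar> \<le> \<delta>"
        and tail: "tail_good m (\<lambda>h. ST h \<omega>)" by (auto intro: less_imp_le)
      let ?k = "kpoly (\<lambda>h. ST h \<omega>)"
      obtain g where g: "uniform_limit {0..1} ?k g sequentially"
        "\<And>t. t \<in> {0..1} \<Longrightarrow> cmod (g t - ?k m t) \<le> 6 * (\<Sum>n. real (n + m) powr (-5/4))"
        by (rule uniform_limit_kpoly[of m "\<lambda>h. ST h \<omega>"]) (use tail in \<open>auto simp: tail_good_def\<close>)
      \<comment> \<open>Three errors of \<epsilon>/4 each: tail, head coefficients, and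
        approximation of f. The remaining quarter keeps the supremum strictly below
        \<epsilon>.\<close>
      have "cmod (K_fun ST \<omega> t - f t) \<le> 3 * \<epsilon> / 4" if t: "t \<in> {0..1}" for t
      proof -
        have K: "K_fun ST \<omega> t = g t"
          by (rule K_fun_uniform_limit[OF _ t]) (use g in \<open>simp add: K_partial_eq_kpoly\<close>)
        have "cmod (?k m t - kpoly y m t) \<le> (2 * real m + 1) * \<delta>"
          by (rule norm_kpoly_diff_le[OF head t])
        also have "\<dots> = \<epsilon> / 4" by (simp add: \<delta>_def field_simps)
        finally have 1: "cmod (?k m t - kpoly y m t) \<le> \<epsilon> / 4" .
        have 2: "cmod (kpoly y m t - f t) < \<epsilon> / 4"
          using y0(2)[OF t] kpoly_truncate[of N m y0 t] by (simp add: y_def[abs_def] m_def)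
        have 3: "cmod (g t - ?k m t) \<le> \<epsilon> / 4"
          using g(2)[OF t] m(1) by linarith
        have "K_fun ST \<omega> t - f t = (g t - ?k m t) + (?k m t - kpoly y m t) + (kpoly y m t - f t)"
          by (simp add: K)
        also have "cmod \<dots> \<le> cmod (g t - ?k m t) + cmod (?k m t - kpoly y m t) + cmod (kpoly y m t - f t)"
          by (intro norm_triangle_le add_right_mono norm_triangle_ineq)
        finally show ?thesis using 1 2 3 by linarith
      qed
      then have "(SUP t\<in>{0..1}. cmod (K_fun ST \<omega> t - f t)) \<le> 3 * \<epsilon> / 4"
        by (intro cSUP_least) auto
      also have "\<dots> < \<epsilon>" using \<open>\<epsilon> > 0\<close> by simp
      finally show "(SUP t\<in>{0..1}. cmod (K_fun ST \<omega> t - f t)) < \<epsilon>" .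
    qed simp
  qed (rule SUP_K_fun_less_sets[OF measurable_ST f])
  finally show "0 < prob {\<omega> \<in> space M. (SUP t\<in>{0..1}. cmod (K_fun ST \<omega> t - f t)) < \<epsilon>}" .
qed

end

theorem theorem1p1:
  fixes M :: "'a measure" and ST :: "int \<Rightarrow> 'a \<Rightarrow> real"
  assumes "prob_space M"
    and "prob_space.indep_vars M (\<lambda>_. borel) ST UNIV"
    and "\<And>h. distr M borel (ST h) = density lborel sato_tate_density"
  shows "K_support M ST =
    {f. continuous_on {0..1} f \<and> f 0 = 0 \<and> f 1 \<in> complex_of_real ` {-2..2} \<and>
        (\<forall>h::int. h \<noteq> 0 \<longrightarrow>
           Re (fourier_coeff (\<lambda>t. f t - of_real t * f 1) h) = 0 \<and>
           cmod (fourier_coeff (\<lambda>t. f t - of_real t * f 1) h) \<le> 1 / (pi * real_of_int \<bar>h\<bar>))}"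
    (is "_ = ?R")
proof -
  interpret sato_tate_family M ST
    using assms by (simp add: sato_tate_family_def sato_tate_family_axioms_def)
  show ?thesis
  proof (intro equalityI subsetI)
    fix f assume f: "f \<in> K_support M ST"
    then have "continuous_on {0..1} f" by (simp add: K_support_def)
    then show "f \<in> ?R"
      using kpoly_closure_imp_fourier[OF _ K_support_imp_kpoly_closure[OF f]] by blast
  next
    fix f assume f: "f \<in> ?R"
    show "f \<in> K_support M ST"
    proof (rule kpoly_closure_imp_K_support)
      fix \<epsilon> :: real assume "\<epsilon> > 0"
      then obtain y N where "\<And>h. \<bar>y h\<bar> \<le> 2" "\<And>t. t \<in> {0..1} \<Longrightarrow> cmod (kpoly y N t - f t) < \<epsilon>"
        using fourier_imp_kpoly_closure[of f \<epsilon>] f by blast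
      then show "\<exists>y N. (\<forall>h. \<bar>y h\<bar> \<le> 2) \<and> (\<forall>t\<in>{0..1}. cmod (kpoly y N t - f t) < \<epsilon>)" by blast
    qed (use f in simp)
  qed
qed

end
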